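(* Let $d\geq 3$, let $\mathcal{F}=V(x^d+y^d+z^d)\subset\mathbb{P}^2$ be the Fermat curve of degree $d$ over $\mathbb{C}$, and let $n\geq 1$. Let $g$ be a non-identity automorphism of $\mathcal{F}$ and let $L_g\subset\mathbb{P}^2$ be a line fixed pointwise by $g$. Let $P_g\subset\mathcal{F}$ be the set of points in an orbit under $g$. Then the osculating curves of degree $n$ to $\mathcal{F}$ at the points of $P_g$ all intersect $L_g$ in the same set of at most $n$ points, and at each of these points all of these osculating curves have the same intersection multiplicity with $L_g$.
   Context: An automorphism of $\mathcal{F}$ here means an automorphism $g\in\operatorname{Aut}(\mathbb{P}^2)$ (a projective linear map) with $g(\mathcal{F})=\mathcal{F}$. For a plane curve $\mathcal{C}$ and a smooth point $p\in\mathcal{C}$, the osculating curve of degree $n$ to $\mathcal{C}$ at $p$ is the unique curve $\Sigma_p$ of degree $n$ with intersection multiplicity $(\mathcal{C}.\Sigma_p)_p\geq\frac12 n(n+3)$; existence and uniqueness of this curve at the points considered is presupposed in speaking of the osculating curve. *)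

theory Defs
  imports
    "HOL-Analysis.Analysis"
    "HOL-Library.Poly_Mapping"
    "HOL-Library.Extended_Nat"
    "HOL-Computational_Algebra.Fraction_Field"
begin

section \<open>Polynomials in three variables\<close>

text \<open>
  A monomial is an exponent vector indexed by the three-element type \<open>3\<close>, whose elements
  \<open>1, 2, 3\<close> (with \<open>3 = 0\<close>) stand for the variables \<open>x, y, z\<close>. The product of \<open>\<Rightarrow>\<^sub>0\<close> is
  convolution, which is multiplication of polynomials.
\<close>

type_synonym poly3 = "(3 \<Rightarrow>\<^sub>0 nat) \<Rightarrow>\<^sub>0 complex"

definition const3 :: "complex \<Rightarrow> poly3" where
  "const3 c = Poly_Mapping.single 0 c"

definition var3 :: "3 \<Rightarrow> poly3" where
  "var3 i = Poly_Mapping.single (Poly_Mapping.single i 1) 1"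

definition eval3 :: "poly3 \<Rightarrow> complex ^ 3 \<Rightarrow> complex" where
  "eval3 f v = (\<Sum>m\<in>Poly_Mapping.keys f. Poly_Mapping.lookup f m * (\<Prod>i\<in>UNIV. (v $ i) ^ Poly_Mapping.lookup m i))"

definition homogeneous :: "nat \<Rightarrow> poly3 \<Rightarrow> bool" where
  "homogeneous k f \<longleftrightarrow> (\<forall>m\<in>Poly_Mapping.keys f. (\<Sum>i\<in>UNIV. Poly_Mapping.lookup m i) = k)"

lemma lookup_const3_mult: "Poly_Mapping.lookup (const3 c * f) m = c * Poly_Mapping.lookup f m"
proof -
  have "const3 c * f = Poly_Mapping.map ((*) c) f"
    by (simp add: const3_def mult_map_scale_conv_mult)
  then show ?thesis by (simp add: Poly_Mapping.map.rep_eq when_def)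
qed

lemma keys_const3_mult: "c \<noteq> 0 \<Longrightarrow> Poly_Mapping.keys (const3 c * f) = Poly_Mapping.keys f"
  by (auto simp: in_keys_iff lookup_const3_mult)

lemma eval3_const3_mult: "c \<noteq> 0 \<Longrightarrow> eval3 (const3 c * f) v = c * eval3 f v"
  by (simp add: eval3_def keys_const3_mult lookup_const3_mult sum_distrib_left mult.assoc)

lemma homogeneous_const3_mult: "c \<noteq> 0 \<Longrightarrow> homogeneous k (const3 c * f) = homogeneous k f"
  by (simp add: homogeneous_def keys_const3_mult)

lemma const3_mult_const3: "const3 a * const3 b = const3 (a * b)"
  by (simp add: const3_def mult_single)

lemma const3_1: "const3 1 = 1"
  by (simp add: const3_def)

lemma eval3_scale:
  assumes "homogeneous k f"
  shows "eval3 f (c *s v) = c ^ k * eval3 f v"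
proof -
  have "(\<Prod>i\<in>UNIV. ((c *s v) $ i) ^ Poly_Mapping.lookup m i) = c ^ k * (\<Prod>i\<in>UNIV. (v $ i) ^ Poly_Mapping.lookup m i)"
    if "m \<in> Poly_Mapping.keys f" for m
    using that assms
    by (simp add: homogeneous_def power_mult_distrib prod.distrib flip: power_sum)
  then show ?thesis
    by (simp add: eval3_def sum_distrib_left mult.left_commute)
qed


section \<open>The complex projective plane and its automorphisms\<close>

definition proj_rel :: "complex ^ 3 \<Rightarrow> complex ^ 3 \<Rightarrow> bool" where
  "proj_rel v w \<longleftrightarrow> v \<noteq> 0 \<and> w \<noteq> 0 \<and> (\<exists>c. c \<noteq> 0 \<and> v = c *s w)"

quotient_type proj_plane = "complex ^ 3" / partial: proj_rel
proof (rule part_equivpI)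
  show "\<exists>v. proj_rel v v"
    by (rule exI[of _ "axis 1 1"], unfold proj_rel_def, intro conjI exI[of _ 1])
      (auto simp: axis_eq_0_iff)
  show "symp proj_rel"
  proof (rule sympI)
    fix v w :: "complex ^ 3"
    assume "proj_rel v w"
    then obtain c where "v \<noteq> 0" "w \<noteq> 0" "c \<noteq> 0" "v = c *s w"
      by (auto simp: proj_rel_def)
    then have "w = inverse c *s v" "inverse c \<noteq> 0"
      by (simp_all add: vector_smult_assoc)
    with \<open>v \<noteq> 0\<close> \<open>w \<noteq> 0\<close> show "proj_rel w v"
      unfolding proj_rel_def by blast
  qed
  show "transp proj_rel"
    unfolding proj_rel_def transp_def by (metis mult_eq_0_iff vector_smult_assoc)
qed

definition proj_automorphism :: "(proj_plane \<Rightarrow> proj_plane) \<Rightarrow> bool" where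
  "proj_automorphism g \<longleftrightarrow>
    (\<exists>A :: complex ^ 3 ^ 3. invertible A \<and>
      (\<forall>v. v \<noteq> 0 \<longrightarrow> g (abs_proj_plane v) = abs_proj_plane (A *v v)))"

text \<open>The orbit of \<open>p\<close> under the cyclic group generated by a bijection \<open>g\<close>; the second disjunct
  accounts for the negative powers of \<open>g\<close>.\<close>

definition cyclic_orbit :: "('a \<Rightarrow> 'a) \<Rightarrow> 'a \<Rightarrow> 'a set" where
  "cyclic_orbit g p = {q. \<exists>k. (g ^^ k) p = q \<or> (g ^^ k) q = p}"


section \<open>Plane curves\<close>

text \<open>A plane curve is a nonzero homogeneous polynomial of positive degree up to a nonzero
  scalar, so that multiple components are taken into account.\<close>

definition curve_rel :: "poly3 \<Rightarrow> poly3 \<Rightarrow> bool" where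
  "curve_rel f h \<longleftrightarrow> f \<noteq> 0 \<and> h \<noteq> 0 \<and> (\<exists>k\<ge>1. homogeneous k f \<and> homogeneous k h) \<and>
    (\<exists>c. c \<noteq> 0 \<and> f = const3 c * h)"

quotient_type plane_curve = poly3 / partial: curve_rel
proof (rule part_equivpI)
  have "Poly_Mapping.keys (var3 1) = {Poly_Mapping.single 1 1}"
    by (simp add: var3_def)
  then have "homogeneous 1 (var3 1)" "var3 1 \<noteq> 0"
    by (auto simp: homogeneous_def lookup_single when_def)
  then have "curve_rel (var3 1) (var3 1)"
    unfolding curve_rel_def by (metis const3_1 le_refl mult_1 one_neq_zero)
  then show "\<exists>f. curve_rel f f" by blast
  show "symp curve_rel"
  proof (rule sympI)
    fix f h
    assume "curve_rel f h"
    then obtain c k where c: "f \<noteq> 0" "h \<noteq> 0" "c \<noteq> 0" "f = const3 c * h"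
        "k \<ge> 1" "homogeneous k f" "homogeneous k h"
      unfolding curve_rel_def by blast
    then have "h = const3 (inverse c) * f" "inverse c \<noteq> 0"
      by (simp_all add: const3_mult_const3 const3_1 flip: mult.assoc)
    with c show "curve_rel h f"
      unfolding curve_rel_def by blast
  qed
  show "transp curve_rel"
  proof (rule transpI)
    fix f h e
    assume "curve_rel f h" "curve_rel h e"
    then obtain a b where "f = const3 a * h" "h = const3 b * e" "a \<noteq> 0" "b \<noteq> 0"
      by (auto simp: curve_rel_def)
    then have "f = const3 (a * b) * e" "a * b \<noteq> 0"
      by (simp_all add: const3_mult_const3 flip: mult.assoc)
    moreover from this \<open>curve_rel f h\<close> \<open>curve_rel h e\<close>
    have "f \<noteq> 0 \<and> e \<noteq> 0 \<and> (\<exists>k\<ge>1. homogeneous k f \<and> homogeneous k e)"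
      by (auto simp: curve_rel_def homogeneous_const3_mult)
    ultimately show "curve_rel f e"
      unfolding curve_rel_def by blast
  qed
qed

lift_definition has_degree :: "plane_curve \<Rightarrow> nat \<Rightarrow> bool" is "\<lambda>f k. homogeneous k f"
  by (auto simp: curve_rel_def fun_eq_iff homogeneous_const3_mult)

lift_definition on_curve :: "proj_plane \<Rightarrow> plane_curve \<Rightarrow> bool" is "\<lambda>v f. eval3 f v = 0"
  by (auto simp: curve_rel_def proj_rel_def eval3_const3_mult eval3_scale)

definition curve_points :: "plane_curve \<Rightarrow> proj_plane set" where
  "curve_points C = {p. on_curve p C}"

definition fermat_curve :: "nat \<Rightarrow> plane_curve" where
  "fermat_curve d = abs_plane_curve (var3 1 ^ d + var3 2 ^ d + var3 3 ^ d)"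


section \<open>Intersection multiplicity\<close>

text \<open>The local ring of the projective plane at the point with homogeneous coordinates \<open>v\<close>, inside
  the fraction field of the polynomial ring: the quotients \<open>a/b\<close> of homogeneous polynomials of the
  same degree with \<open>b(v) \<noteq> 0\<close>.\<close>

definition local_ring :: "complex ^ 3 \<Rightarrow> poly3 fract set" where
  "local_ring v = {Fract a b | a b k. homogeneous k a \<and> homogeneous k b \<and> eval3 b v \<noteq> 0}"

text \<open>The ideal of the local ring generated by a local equation \<open>f/l\<^sup>k\<close> of the curve \<open>f = 0\<close>, where
  \<open>k\<close> is the degree of \<open>f\<close> and \<open>l\<close> any linear form with \<open>l(v) \<noteq> 0\<close>; it consists of the fractions
  whose numerator can be chosen to be a multiple of \<open>f\<close>.\<close>

definition local_ideal :: "poly3 \<Rightarrow> complex ^ 3 \<Rightarrow> poly3 fract set" where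
  "local_ideal f v =
    {Fract a b | a b k. homogeneous k a \<and> homogeneous k b \<and> f dvd a \<and> eval3 b v \<noteq> 0}"

text \<open>The complex dimension of the quotient space \<open>R/I\<close>: the supremum of the sizes of the finite
  subsets of \<open>R\<close> that are linearly independent modulo \<open>I\<close>.\<close>

definition quotient_dim :: "poly3 fract set \<Rightarrow> poly3 fract set \<Rightarrow> enat" where
  "quotient_dim R I = Sup {enat (card B) | B. finite B \<and> B \<subseteq> R \<and>
    (\<forall>c :: poly3 fract \<Rightarrow> complex.
      (\<Sum>b\<in>B. Fract (const3 (c b)) 1 * b) \<in> I \<longrightarrow> (\<forall>b\<in>B. c b = 0))}"

lemma const3_mult_dvd_iff: "c \<noteq> 0 \<Longrightarrow> const3 c * f dvd a \<longleftrightarrow> f dvd a"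
proof
  assume "c \<noteq> 0" "f dvd a"
  then obtain e where "a = f * e" by (auto elim: dvdE)
  then have "a = (const3 c * f) * (const3 (inverse c) * e)"
    using const3_mult_const3[of c "inverse c"] \<open>c \<noteq> 0\<close>
    by (simp add: const3_1 mult_ac flip: mult.assoc[of "const3 c" "const3 (inverse c)"])
  then show "const3 c * f dvd a" by (rule dvdI)
qed (rule dvd_mult_right)

lemma local_ring_cong: "proj_rel v w \<Longrightarrow> local_ring v = local_ring w"
proof -
  assume "proj_rel v w"
  then have "eval3 b v = 0 \<longleftrightarrow> eval3 b w = 0" if "homogeneous k b" for k b
    using that by (auto simp: proj_rel_def eval3_scale)
  then show ?thesis by (auto simp: local_ring_def) blast+
qed

lemma local_ideal_cong:
  assumes "proj_rel v w" "curve_rel f h"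
  shows "local_ideal f v = local_ideal h w"
proof -
  have "eval3 b v = 0 \<longleftrightarrow> eval3 b w = 0" if "homogeneous k b" for k b
    using that assms(1) by (auto simp: proj_rel_def eval3_scale)
  moreover have "f dvd a \<longleftrightarrow> h dvd a" for a
    using assms(2) by (auto simp: curve_rel_def const3_mult_dvd_iff)
  ultimately show ?thesis by (auto simp: local_ideal_def) blast+
qed

text \<open>\<open>intersection_mult C D p\<close> is \<open>(C.D)\<^sub>p\<close>; it is infinite if \<open>C\<close> and \<open>D\<close> share a component
  through \<open>p\<close>.\<close>

lift_definition intersection_mult :: "plane_curve \<Rightarrow> plane_curve \<Rightarrow> proj_plane \<Rightarrow> enat" is
  "\<lambda>f h v. quotient_dim (local_ring v) {a + b | a b. a \<in> local_ideal f v \<and> b \<in> local_ideal h v}"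
  by (simp add: local_ring_cong local_ideal_cong)


section \<open>Osculating curves\<close>

text \<open>Note that \<open>n (n + 3)\<close> is even.\<close>

definition is_osculating_curve :: "nat \<Rightarrow> plane_curve \<Rightarrow> proj_plane \<Rightarrow> plane_curve \<Rightarrow> bool" where
  "is_osculating_curve n C p D \<longleftrightarrow>
    has_degree D n \<and> intersection_mult C D p \<ge> enat (n * (n + 3) div 2)"

text \<open>Only meaningful when there is exactly one such curve.\<close>

definition osculating_curve :: "nat \<Rightarrow> plane_curve \<Rightarrow> proj_plane \<Rightarrow> plane_curve" where
  "osculating_curve n C p = (THE D. is_osculating_curve n C p D)"

end

theory Submission
  imports Defs
begin

text \<open>
  A linear map \<open>A\<close> inducing \<open>g\<close> multiplies the Fermat polynomial \<open>F\<close> by a constant, and substituting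
  \<open>A\<close> preserves intersection multiplicities. So \<open>g\<close> carries the osculating curve at \<open>q\<close> to the one at
  \<open>g q\<close>; since \<open>g\<close> fixes every point of the line \<open>L\<close>, both meet \<open>L\<close> in the same way.

  The bound \<open>n\<close> requires that \<open>L\<close> is not a component of an osculating curve. If \<open>L\<close> is \<open>l = 0\<close>, then
  \<open>A\<close> can be scaled to \<open>v \<mapsto> v + l(v) u\<close>, and comparing derivatives of \<open>F(v + l(v) u) = c F(v)\<close> shows
  that \<open>L\<close> is nowhere tangent to the Fermat curve. Hence a component \<open>L\<close> of an osculating curve could be
  replaced by another line (through the point, if \<open>L\<close> passes through it) without decreasing the
  intersection multiplicity, which contradicts uniqueness.
\<close>

section \<open>Evaluation of polynomials\<close>

text \<open>Exchanging the line \<open>l = 0\<close> for \<open>m = 0\<close> works directly with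
  the definition of the multiplicity as a dimension, without additivity over components. It rests on
  a relation \<open>G * m = K * f + H * l\<close> with \<open>G\<close> nonzero at the point. In the
  local ring \<open>G\<close> is a unit, so \<open>m\<close> is a multiple of \<open>l\<close>
  modulo \<open>f\<close>; the ideal generated by \<open>f\<close> and \<open>m * h\<close> is then
  contained in that of \<open>f\<close> and \<open>l * h\<close>, and its quotient is at least as
  large. Off the line \<open>l = 0\<close> the relation is trivial, since \<open>l\<close> itself is
  a unit there. On the line, transversality provides it: \<open>l\<close> is a local parameter of
  the Fermat curve, so every linear form vanishing at the point is a multiple of \<open>l\<close>
  along the curve. That \<open>F\<close> is multiplied by a constant needs an argument too, as
  \<open>g\<close> is only known to preserve a set of points. It uses that the forms of degree
  \<open>d\<close> vanishing on the Fermat curve are the multiples of \<open>F\<close>.\<close>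

lemma eval3_superset:
  assumes "finite X" "Poly_Mapping.keys f \<subseteq> X"
  shows "eval3 f v = (\<Sum>m\<in>X. Poly_Mapping.lookup f m * (\<Prod>i\<in>UNIV. (v $ i) ^ Poly_Mapping.lookup m i))"
  unfolding eval3_def by (rule sum.mono_neutral_left) (use assms in \<open>auto simp: in_keys_iff\<close>)

lemma eval3_single: "eval3 (Poly_Mapping.single m c) v = c * (\<Prod>i\<in>UNIV. (v $ i) ^ Poly_Mapping.lookup m i)"
  by (subst eval3_superset[of "{m}"]) auto

lemma eval3_0 [simp]: "eval3 0 v = 0"
  by (simp add: eval3_def)

lemma eval3_add [simp]: "eval3 (f + h) v = eval3 f v + eval3 h v"
  by (simp add: eval3_superset[of "Poly_Mapping.keys f \<union> Poly_Mapping.keys h"] Poly_Mapping.keys_add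
      lookup_add ring_distribs sum.distrib)

lemma eval3_sum [simp]: "eval3 (sum f X) v = (\<Sum>x\<in>X. eval3 (f x) v)"
  by (induction X rule: infinite_finite_induct) simp_all

lemma poly_mapping_sum_single: "(\<Sum>m\<in>Poly_Mapping.keys f. Poly_Mapping.single m (Poly_Mapping.lookup f m)) = f"
  by (rule poly_mapping_eqI) (auto simp: lookup_sum lookup_single when_def in_keys_iff)

text \<open>Both sides are bilinear in \<open>f\<close> and \<open>h\<close>, and on single
  monomials the claim is that exponents add up.\<close>

lemma eval3_mult [simp]: "eval3 (f * h) v = eval3 f v * eval3 h v"
proof -
  define F H where "F m = Poly_Mapping.single m (Poly_Mapping.lookup f m)"
    and "H m = Poly_Mapping.single m (Poly_Mapping.lookup h m)" for m
  have 1: "eval3 (F m * H m') v = eval3 (F m) v * eval3 (H m') v" for m m'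
    by (simp add: F_def H_def mult_single eval3_single lookup_add power_add prod.distrib)
  have FH: "sum F (Poly_Mapping.keys f) = f" "sum H (Poly_Mapping.keys h) = h"
    by (simp_all add: F_def H_def poly_mapping_sum_single)
  have "eval3 (sum F X * sum H Y) v = eval3 (sum F X) v * eval3 (sum H Y) v" for X Y
    by (simp add: 1 sum_product)
  from this[of "Poly_Mapping.keys f" "Poly_Mapping.keys h"] show ?thesis by (simp only: FH)
qed

lemma eval3_const3 [simp]: "eval3 (const3 c) v = c"
  by (simp add: const3_def eval3_single)

lemma prod_power_single: "(\<Prod>i\<in>UNIV. x i ^ Poly_Mapping.lookup (Poly_Mapping.single j k) i) = (x j :: 'a::comm_monoid_mult) ^ k"
  for j :: "'i::finite"
proof -
  have "(\<Prod>i\<in>UNIV. x i ^ Poly_Mapping.lookup (Poly_Mapping.single j k) i) = (\<Prod>i\<in>UNIV. if j = i then x j ^ k else 1)"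
    by (rule prod.cong) (auto simp: lookup_single when_def)
  then show ?thesis by simp
qed

lemma eval3_var3 [simp]: "eval3 (var3 j) v = v $ j"
  by (simp add: var3_def eval3_single prod_power_single)

lemma eval3_1 [simp]: "eval3 1 v = 1"
  using eval3_const3[of 1] by (simp add: const3_1)

lemma eval3_power [simp]: "eval3 (f ^ k) v = eval3 f v ^ k"
  by (induction k) simp_all

lemma eval3_diff [simp]: "eval3 (f - h) v = eval3 f v - eval3 h v"
  by (metis eval3_add add_diff_cancel_right' diff_add_cancel)

lemma eval3_prod [simp]: "eval3 (prod f X) v = (\<Prod>x\<in>X. eval3 (f x) v)"
  by (induction X rule: infinite_finite_induct) simp_all

lemma prod_3: "prod f (UNIV :: 3 set) = f 1 * f 2 * f 3"
  unfolding UNIV_3 by (simp add: ac_simps)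

text \<open>Tells apart the exponents in the Kronecker substitution below: the three exponents of a
  monomial become the base \<open>N\<close> digits of one number, the last being an unbounded
  leading digit.\<close>

lemma base_expansion_unique:
  fixes a b c N :: nat
  assumes "a + N * (b + N * c) = a' + N * (b' + N * c')" "a < N" "b < N" "a' < N" "b' < N"
  shows "a = a' \<and> b = b' \<and> c = c'"
proof -
  have step: "x = x' \<and> y = y'" if "x + N * y = x' + N * y'" "x < N" "x' < N" for x y x' y'
  proof -
    have "(x + N * y) mod N = (x' + N * y') mod N" "(x + N * y) div N = (x' + N * y') div N"
      by (simp_all only: that(1))
    then show ?thesis using that(2,3) by simp
  qed
  show ?thesis
    using step[OF assms(1,2,4)] step[OF _ assms(3,5)] by blast
qed

text \<open>Kronecker substitution: for \<open>N\<close> larger than all exponents, \<open>(t, t^N, t^(N * N))\<close> sends distinct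
  monomials of \<open>f\<close> to distinct powers of \<open>t\<close>.\<close>

lemma eval3_nonzero:
  assumes "f \<noteq> 0"
  shows "\<exists>v. eval3 f v \<noteq> 0"
proof -
  obtain m0 where m0: "m0 \<in> Poly_Mapping.keys f" using assms by (metis all_not_in_conv keys_eq_empty)
  define X where "X = (\<lambda>(m, i). Poly_Mapping.lookup m i) ` (Poly_Mapping.keys f \<times> UNIV)"
  define N where "N = Suc (Max X)"
  have "finite X" by (simp add: X_def)
  have less: "Poly_Mapping.lookup m i < N" if "m \<in> Poly_Mapping.keys f" for m i
  proof -
    have "Poly_Mapping.lookup m i \<in> X" using that by (force simp: X_def)
    then show ?thesis using \<open>finite X\<close> by (simp add: N_def less_Suc_eq_le)
  qed
  define e where "e m = Poly_Mapping.lookup m 1 + N * (Poly_Mapping.lookup m 2 + N * Poly_Mapping.lookup m 3)"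
    for m :: "3 \<Rightarrow>\<^sub>0 nat"
  have inj: "m = m'" if "e m = e m'" "m \<in> Poly_Mapping.keys f" "m' \<in> Poly_Mapping.keys f" for m m'
  proof -
    have "\<forall>i. Poly_Mapping.lookup m i = Poly_Mapping.lookup m' i"
      unfolding forall_3
      by (rule base_expansion_unique[OF that(1)[unfolded e_def]]) (rule less that)+
    then show ?thesis by (simp add: poly_mapping_eq_iff fun_eq_iff)
  qed
  define P where "P = (\<Sum>m\<in>Poly_Mapping.keys f. Polynomial.monom (Poly_Mapping.lookup f m) (e m))"
  have "coeff P (e m0) = (\<Sum>m\<in>Poly_Mapping.keys f. if m = m0 then Poly_Mapping.lookup f m else 0)"
    unfolding P_def coeff_sum by (rule sum.cong) (auto dest: inj[OF _ _ m0])
  also have "\<dots> = Poly_Mapping.lookup f m0" using m0 by simp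
  also have "\<dots> \<noteq> 0" using m0 by (simp add: in_keys_iff)
  finally have "P \<noteq> 0" by auto
  then have "finite {t. poly P t = 0}" by (rule poly_roots_finite)
  then obtain t where t: "poly P t \<noteq> 0"
    using infinite_UNIV_char_0[where 'a = complex] by (cases "\<forall>t. poly P t = 0") auto
  have "(\<Prod>i\<in>UNIV. (vector [t, t ^ N, t ^ (N * N)] :: complex ^ 3) $ i ^ Poly_Mapping.lookup m i) = t ^ e m" for m
    unfolding prod_3 vector_3 e_def by (simp only: power_add power_mult mult.assoc)
  then have "eval3 f (vector [t, t ^ N, t ^ (N * N)]) = poly P t"
    by (simp add: eval3_def P_def poly_sum poly_monom)
  with t have "eval3 f (vector [t, t ^ N, t ^ (N * N)]) \<noteq> 0" by simp
  then show ?thesis by (rule exI)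
qed

text \<open>Most polynomial identities below are checked at points, which avoids computing with
  coefficients.\<close>

lemma eval3_eqI: "(\<And>v. eval3 f v = eval3 h v) \<Longrightarrow> f = h"
  using eval3_nonzero[of "f - h"] by auto

section \<open>Homogeneity\<close>

abbreviation mdeg :: "(3 \<Rightarrow>\<^sub>0 nat) \<Rightarrow> nat" where
  "mdeg m \<equiv> \<Sum>i\<in>UNIV. Poly_Mapping.lookup m i"

lemma homogeneous_0 [simp]: "homogeneous k 0"
  by (simp add: homogeneous_def)

lemma homogeneous_add: "homogeneous k f \<Longrightarrow> homogeneous k h \<Longrightarrow> homogeneous k (f + h)"
  using Poly_Mapping.keys_add[of f h] by (auto simp: homogeneous_def)

lemma homogeneous_diff: "homogeneous k f \<Longrightarrow> homogeneous k h \<Longrightarrow> homogeneous k (f - h)"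
  using keys_diff[of f h] by (auto simp: homogeneous_def)

lemma homogeneous_sum: "(\<And>x. x \<in> X \<Longrightarrow> homogeneous k (f x)) \<Longrightarrow> homogeneous k (sum f X)"
  by (induction X rule: infinite_finite_induct) (simp_all add: homogeneous_add)

lemma homogeneous_mult: "homogeneous j f \<Longrightarrow> homogeneous k h \<Longrightarrow> homogeneous (j + k) (f * h)"
  using keys_mult[of f h] by (auto simp: homogeneous_def lookup_add sum.distrib dest!: subsetD)

lemma homogeneous_const3 [simp]: "homogeneous 0 (const3 c)"
  by (simp add: homogeneous_def const3_def)

lemma homogeneous_1 [simp]: "homogeneous 0 1"
  using homogeneous_const3[of 1] by (simp only: const3_1)

lemma homogeneous_var3 [simp]: "homogeneous 1 (var3 i)"
  by (simp add: homogeneous_def var3_def lookup_single when_def)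

lemma homogeneous_cmult: "homogeneous k f \<Longrightarrow> homogeneous k (const3 c * f)"
  using homogeneous_mult[OF homogeneous_const3, of k f c] by simp

lemma homogeneous_power: "homogeneous k f \<Longrightarrow> homogeneous (r * k) (f ^ r)"
  by (induction r) (simp_all add: homogeneous_mult)

lemma homogeneous_prod: "(\<And>x. x \<in> X \<Longrightarrow> homogeneous (k x) (f x)) \<Longrightarrow> homogeneous (sum k X) (prod f X)"
  by (induction X rule: infinite_finite_induct) (simp_all add: homogeneous_mult)

text \<open>The part \<open>e1\<close> of \<open>e\<close> in one degree contributes to
  \<open>h * e\<close> in a degree of its own. If that degree is not \<open>k\<close>, then
  \<open>h * e1\<close> vanishes and hence so does \<open>e1\<close>, as the polynomials form a
  domain.\<close>

lemma homogeneous_factor: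
  assumes h: "homogeneous i h" "h \<noteq> 0" and he: "homogeneous k (h * e)" and "e \<noteq> 0"
  shows "\<exists>j. k = i + j \<and> homogeneous j e"
proof -
  have 0: "k = i + mdeg m" if m: "m \<in> Poly_Mapping.keys e" for m
  proof (rule ccontr)
    assume neq: "k \<noteq> i + mdeg m"
    define K where "K = {m' \<in> Poly_Mapping.keys e. mdeg m' = mdeg m}"
    define e1 where "e1 = (\<Sum>m'\<in>K. Poly_Mapping.single m' (Poly_Mapping.lookup e m'))"
    have lookup_e1: "Poly_Mapping.lookup e1 m' = (if mdeg m' = mdeg m then Poly_Mapping.lookup e m' else 0)" for m'
      by (auto simp: e1_def K_def lookup_sum lookup_single when_def in_keys_iff)
    have hom: "homogeneous (i + mdeg m) (h * e1)"
      by (rule homogeneous_mult[OF h(1)]) (auto simp: homogeneous_def in_keys_iff lookup_e1 split: if_splits)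
    have "Poly_Mapping.lookup (h * e1) M = 0" for M
    proof (cases "mdeg M = i + mdeg m")
      case True
      \<comment> \<open>\<open>e - e1\<close> has no monomial of degree \<open>mdeg m\<close>, so
        its product with \<open>h\<close> has none of degree \<open>i + mdeg m\<close>.\<close>
      have "M \<notin> Poly_Mapping.keys (h * (e - e1))"
      proof
        assume "M \<in> Poly_Mapping.keys (h * (e - e1))"
        then obtain a b where ab: "M = a + b" "a \<in> Poly_Mapping.keys h" "b \<in> Poly_Mapping.keys (e - e1)"
          using keys_mult[of h "e - e1"] by blast
        then have "mdeg b = mdeg m"
          using h(1) True by (simp add: homogeneous_def lookup_add sum.distrib)
        with ab(3) show False by (simp add: in_keys_iff lookup_minus lookup_e1)
      qed
      moreover have "M \<notin> Poly_Mapping.keys (h * e)"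
        using he True neq by (auto simp: homogeneous_def)
      ultimately show ?thesis
        by (simp add: in_keys_iff lookup_minus right_diff_distrib)
    next
      case False
      with hom show ?thesis by (auto simp: homogeneous_def in_keys_iff)
    qed
    then have "h * e1 = 0" by (intro poly_mapping_eqI) simp
    then have "e1 = 0" using h(2) by simp
    with lookup_e1[of m] m show False by (simp add: in_keys_iff)
  qed
  obtain m0 where m0: "m0 \<in> Poly_Mapping.keys e"
    using \<open>e \<noteq> 0\<close> by (metis all_not_in_conv keys_eq_empty)
  have "homogeneous (mdeg m0) e"
    unfolding homogeneous_def using 0 0[OF m0] by (metis add_left_cancel)
  with 0[OF m0] show ?thesis by blast
qed

section \<open>Linear forms\<close>

definition lin3 :: "complex ^ 3 \<Rightarrow> poly3" where
  "lin3 a = (\<Sum>i\<in>UNIV. const3 (a $ i) * var3 i)"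

text \<open>There is no conjugation, unlike in \<open>inner\<close>: a vector \<open>a\<close> also
  serves as the coefficient vector of the line \<open>lin3 a = 0\<close>.\<close>

definition bil3 :: "complex ^ 3 \<Rightarrow> complex ^ 3 \<Rightarrow> complex" where
  "bil3 a v = (\<Sum>i\<in>UNIV. a $ i * v $ i)"

lemma eval3_lin3 [simp]: "eval3 (lin3 a) v = bil3 a v"
  by (simp add: lin3_def bil3_def)

lemma homogeneous_lin3 [simp]: "homogeneous 1 (lin3 a)"
  unfolding lin3_def by (intro homogeneous_sum homogeneous_cmult homogeneous_var3)

lemma bil3_add: "bil3 a (v + w) = bil3 a v + bil3 a w"
  by (simp add: bil3_def ring_distribs sum.distrib)

lemma bil3_diff: "bil3 a (v - w) = bil3 a v - bil3 a w"
  by (simp add: bil3_def ring_distribs sum_subtractf)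

lemma bil3_scale: "bil3 a (c *s v) = c * bil3 a v"
  by (simp add: bil3_def sum_distrib_left mult_ac)

lemma bil3_commute: "bil3 a b = bil3 b a"
  by (simp add: bil3_def mult.commute)

lemma bil3_axis: "bil3 a (axis i 1) = a $ i"
proof -
  have "bil3 a (axis i 1) = (\<Sum>j\<in>UNIV. if j = i then a $ i else 0)"
    unfolding bil3_def by (rule sum.cong) (auto simp: axis_def)
  then show ?thesis by simp
qed

lemma homogeneous_1_lin3:
  assumes "homogeneous 1 l"
  obtains a where "l = lin3 a"
proof
  let ?a = "\<chi> i. Poly_Mapping.lookup l (Poly_Mapping.single i 1)"
  show "l = lin3 ?a"
  proof (rule poly_mapping_eqI)
    fix m
    have inj: "Poly_Mapping.single i (1::nat) = Poly_Mapping.single j 1 \<longleftrightarrow> i = j" for i j :: 3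
      by (metis lookup_single_eq lookup_single_not_eq one_neq_zero)
    have lookup_lin: "Poly_Mapping.lookup (lin3 ?a) m = (\<Sum>i\<in>UNIV. if Poly_Mapping.single i 1 = m then ?a $ i else 0)"
      by (auto simp: lin3_def lookup_sum lookup_const3_mult var3_def lookup_single when_def intro!: sum.cong)
    show "Poly_Mapping.lookup l m = Poly_Mapping.lookup (lin3 ?a) m"
    proof (cases "\<exists>i. m = Poly_Mapping.single i 1")
      case True
      then obtain i where i: "m = Poly_Mapping.single i 1" by blast
      show ?thesis unfolding lookup_lin using i by (simp add: inj del: One_nat_def)
    next
      case False
      have "m \<notin> Poly_Mapping.keys l"
      proof
        assume "m \<in> Poly_Mapping.keys l"
        then have *: "mdeg m = 1" using assms by (simp add: homogeneous_def)
        then obtain i where i: "Poly_Mapping.lookup m i \<noteq> 0"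
          by (metis sum.neutral zero_neq_one)
        have "mdeg m = Poly_Mapping.lookup m i + (\<Sum>j\<in>UNIV - {i}. Poly_Mapping.lookup m j)"
          by (rule sum.remove) auto
        with * i have "Poly_Mapping.lookup m i = 1" "(\<Sum>j\<in>UNIV - {i}. Poly_Mapping.lookup m j) = 0"
          by linarith+
        then have "Poly_Mapping.lookup m j = Poly_Mapping.lookup (Poly_Mapping.single i 1) j" for j
          by (cases "j = i") (auto simp: lookup_single)
        then have "m = Poly_Mapping.single i 1"
          by (rule poly_mapping_eqI)
        with False show False by blast
      qed
      with False show ?thesis
        unfolding lookup_lin by (auto simp: in_keys_iff intro!: sum.neutral)
    qed
  qed
qed

section \<open>Linear substitutions\<close>

definition subst3 :: "complex ^ 3 ^ 3 \<Rightarrow> poly3 \<Rightarrow> poly3" where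
  "subst3 A f = (\<Sum>m\<in>Poly_Mapping.keys f.
    const3 (Poly_Mapping.lookup f m) * (\<Prod>i\<in>UNIV. lin3 (A $ i) ^ Poly_Mapping.lookup m i))"

lemma matrix_vector_mult_nth: "(A *v v) $ i = bil3 (A $ i) v"
  by (simp add: matrix_vector_mult_def bil3_def)

lemma eval3_subst3 [simp]: "eval3 (subst3 A f) v = eval3 f (A *v v)"
  by (simp add: subst3_def matrix_vector_mult_nth eval3_def[of f])

lemma subst3_add: "subst3 A (f + h) = subst3 A f + subst3 A h"
  by (rule eval3_eqI) simp

lemma subst3_mult: "subst3 A (f * h) = subst3 A f * subst3 A h"
  by (rule eval3_eqI) simp

lemma subst3_const3: "subst3 A (const3 c) = const3 c"
  by (rule eval3_eqI) simp

lemma subst3_0: "subst3 A 0 = 0"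
  by (rule eval3_eqI) simp

lemma subst3_1: "subst3 A 1 = 1"
  by (rule eval3_eqI) simp

lemma subst3_subst3: "subst3 A (subst3 B f) = subst3 (B ** A) f"
  by (rule eval3_eqI) (simp add: matrix_vector_mul_assoc)

lemma subst3_mat_1: "subst3 (mat 1) f = f"
  by (rule eval3_eqI) simp

lemma homogeneous_subst3:
  assumes "homogeneous k f"
  shows "homogeneous k (subst3 A f)"
proof -
  have "homogeneous k (const3 (Poly_Mapping.lookup f m) * (\<Prod>i\<in>UNIV. lin3 (A $ i) ^ Poly_Mapping.lookup m i))"
    if "m \<in> Poly_Mapping.keys f" for m
  proof -
    have pow: "homogeneous (Poly_Mapping.lookup m i) (lin3 (A $ i) ^ Poly_Mapping.lookup m i)" for i
      using homogeneous_power[OF homogeneous_lin3] by simp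
    have "homogeneous (mdeg m) (\<Prod>i\<in>UNIV. lin3 (A $ i) ^ Poly_Mapping.lookup m i)"
      by (rule homogeneous_prod) (rule pow)
    moreover have "mdeg m = k" using assms that by (simp add: homogeneous_def)
    ultimately show ?thesis by (simp add: homogeneous_cmult)
  qed
  then show ?thesis unfolding subst3_def by (rule homogeneous_sum)
qed

lemma subst3_inverse:
  assumes "invertible A"
  shows "\<exists>B. invertible B \<and> (\<forall>f. subst3 A (subst3 B f) = f) \<and> (\<forall>f. subst3 B (subst3 A f) = f)"
proof -
  obtain B where "A ** B = mat 1" "B ** A = mat 1"
    using assms by (auto simp: invertible_def)
  moreover from this have "invertible B" by (auto simp: invertible_def)
  ultimately show ?thesis by (intro exI[of _ B]) (simp add: subst3_subst3 subst3_mat_1)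
qed

lemma subst3_eq_iff:
  assumes "invertible A"
  shows "subst3 A f = subst3 A h \<longleftrightarrow> f = h"
proof
  assume "subst3 A f = subst3 A h"
  then have "subst3 B (subst3 A f) = subst3 B (subst3 A h)" for B by simp
  with subst3_inverse[OF assms] show "f = h" by metis
qed simp

lemma subst3_eq_0_iff: "invertible A \<Longrightarrow> subst3 A f = 0 \<longleftrightarrow> f = 0"
  using subst3_eq_iff[of A f 0] by (simp add: subst3_0)

lemma subst3_dvd_iff:
  assumes "invertible A"
  shows "subst3 A f dvd subst3 A h \<longleftrightarrow> f dvd h"
proof
  assume "subst3 A f dvd subst3 A h"
  then obtain e where "subst3 A h = subst3 A f * e" by (rule dvdE)
  moreover obtain e' where "subst3 A e' = e" using subst3_inverse[OF assms] by blast
  ultimately have "subst3 A h = subst3 A (f * e')" by (simp add: subst3_mult)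
  then show "f dvd h" using subst3_eq_iff[OF assms] by simp
next
  assume "f dvd h"
  then obtain e where "h = f * e" by (rule dvdE)
  then show "subst3 A f dvd subst3 A h" by (simp add: subst3_mult)
qed

text \<open>Modulo \<open>l\<close>, the substitution of \<open>v - l(v) e\<close> for \<open>v\<close> does not change a polynomial, and it makes
  it vanish if the line \<open>l = 0\<close> lies in its zero set.\<close>

lemma lin3_dvd:
  assumes e: "bil3 a e = 1" and f: "\<And>v. bil3 a v = 0 \<Longrightarrow> eval3 f v = 0"
  shows "lin3 a dvd f"
proof -
  define A :: "complex ^ 3 ^ 3" where "A = (\<chi> i. axis i 1 - (e $ i) *s a)"
  have lin: "lin3 (A $ i) = var3 i - const3 (e $ i) * lin3 a" for i
  proof (rule eval3_eqI)
    fix v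
    have "bil3 v (axis i 1 - (e $ i) *s a) = v $ i - e $ i * bil3 v a"
      by (simp only: bil3_diff bil3_scale bil3_axis)
    then show "eval3 (lin3 (A $ i)) v = eval3 (var3 i - const3 (e $ i) * lin3 a) v"
      by (simp add: A_def bil3_commute[of _ v])
  qed
  have Av: "A *v v = v - bil3 a v *s e" for v
  proof (rule vec_eq_iff[THEN iffD2], rule allI)
    fix i
    have "(A *v v) $ i = eval3 (lin3 (A $ i)) v" by (simp add: matrix_vector_mult_nth)
    then show "(A *v v) $ i = (v - bil3 a v *s e) $ i" by (simp add: lin)
  qed
  have "subst3 A f = 0"
    by (rule eval3_eqI) (simp add: Av f bil3_diff bil3_scale e)
  \<comment> \<open>Congruence modulo \<open>l\<close> is compatible with products and powers, so it
    passes from the variables to all monomials.\<close>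
  have dvd_mult: "l dvd p * q - p' * q'" if "l dvd p - p'" "l dvd q - q'" for l p p' q q' :: poly3
  proof -
    have "p * q - p' * q' = (p - p') * q + p' * (q - q')" by (simp add: algebra_simps)
    then show ?thesis using that by simp
  qed
  have dvd_power: "l dvd p ^ r - p' ^ r" if "l dvd p - p'" for l p p' :: poly3 and r
    by (induction r) (auto intro: dvd_mult that)
  have dvd_prod: "l dvd (\<Prod>i\<in>X. p i) - (\<Prod>i\<in>X. p' i)" if "\<And>i. l dvd p i - p' i"
    for l :: poly3 and p p' :: "3 \<Rightarrow> poly3" and X
    by (induction X rule: infinite_finite_induct) (auto intro: dvd_mult that)
  have expand: "f = (\<Sum>m\<in>Poly_Mapping.keys f.
      const3 (Poly_Mapping.lookup f m) * (\<Prod>i\<in>UNIV. var3 i ^ Poly_Mapping.lookup m i))"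
    by (rule eval3_eqI) (simp add: eval3_def[of f])
  have "f - subst3 A f = (\<Sum>m\<in>Poly_Mapping.keys f. const3 (Poly_Mapping.lookup f m) *
      ((\<Prod>i\<in>UNIV. var3 i ^ Poly_Mapping.lookup m i) - (\<Prod>i\<in>UNIV. lin3 (A $ i) ^ Poly_Mapping.lookup m i)))"
    by (subst (1) expand) (simp add: subst3_def right_diff_distrib sum_subtractf)
  moreover have "lin3 a dvd \<dots>"
    by (intro dvd_sum dvd_mult2 dvd_prod dvd_power Rings.dvd_mult) (simp add: lin)
  ultimately show ?thesis using \<open>subst3 A f = 0\<close> by simp
qed

section \<open>Intersection multiplicities\<close>

text \<open>Independence modulo the larger set implies independence modulo the smaller one. This
  turns inclusions of ideals into inequalities of multiplicities.\<close>

lemma quotient_dim_antimono: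
  assumes "I \<subseteq> J"
  shows "quotient_dim R J \<le> quotient_dim R I"
  unfolding quotient_dim_def
  by (rule Sup_subset_mono) (use assms in blast)

text \<open>An injective linear map matches the finite sets independent modulo \<open>I\<close> with
  their images, which have the same size.\<close>

lemma quotient_dim_image:
  assumes inj: "inj \<phi>" and add: "\<And>x y. \<phi> (x + y) = \<phi> x + \<phi> y"
    and scale: "\<And>c x. \<phi> (Fract (const3 c) 1 * x) = Fract (const3 c) 1 * \<phi> x"
  shows "quotient_dim (\<phi> ` R) (\<phi> ` I) = quotient_dim R I"
proof -
  have "\<phi> 0 + \<phi> 0 = \<phi> 0 + 0" using add[of 0 0] by (simp only: add_0_right)
  then have zero: "\<phi> 0 = 0" by (rule add_left_imp_eq)
  have sum: "\<phi> (sum f B) = (\<Sum>b\<in>B. \<phi> (f b))" for f :: "poly3 fract \<Rightarrow> _" and B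
    by (induction B rule: infinite_finite_induct) (simp_all add: add zero)
  define indep where "indep I B \<longleftrightarrow> (\<forall>c :: poly3 fract \<Rightarrow> complex.
      (\<Sum>b\<in>B. Fract (const3 (c b)) 1 * b) \<in> I \<longrightarrow> (\<forall>b\<in>B. c b = 0))" for I B
  have inj_B: "inj_on \<phi> B" for B using inj by (rule inj_on_subset) simp
  have indep_image: "indep (\<phi> ` I) (\<phi> ` B) \<longleftrightarrow> indep I B" for B
  proof -
    have eq: "(\<Sum>b\<in>\<phi> ` B. Fract (const3 (c b)) 1 * b) \<in> \<phi> ` I \<longleftrightarrow> (\<Sum>b\<in>B. Fract (const3 (c (\<phi> b))) 1 * b) \<in> I" for c
      by (simp only: sum.reindex[OF inj_B] comp_def scale[symmetric] sum[symmetric] inj_image_mem_iff[OF inj])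
    show ?thesis
    proof
      assume l: "indep (\<phi> ` I) (\<phi> ` B)"
      show "indep I B"
        unfolding indep_def
      proof (intro allI impI)
        fix c :: "poly3 fract \<Rightarrow> complex"
        assume c: "(\<Sum>b\<in>B. Fract (const3 (c b)) 1 * b) \<in> I"
        \<comment> \<open>Coefficients on \<open>B\<close> are transported to the image along
          \<open>inv \<phi>\<close>.\<close>
        have inv: "c (inv \<phi> (\<phi> b)) = c b" for b using inj by simp
        have "(\<Sum>b\<in>\<phi> ` B. Fract (const3 (c (inv \<phi> b))) 1 * b) \<in> \<phi> ` I"
          unfolding eq[of "\<lambda>b. c (inv \<phi> b)"] by (simp only: inv c)
        then have "\<forall>b\<in>\<phi> ` B. c (inv \<phi> b) = 0"
          using l[unfolded indep_def, THEN spec[of _ "\<lambda>b. c (inv \<phi> b)"]] by (rule rev_mp)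
        then show "\<forall>b\<in>B. c b = 0" by (simp add: inv)
      qed
    next
      assume r: "indep I B"
      have "\<forall>b\<in>B. c (\<phi> b) = 0" if "(\<Sum>b\<in>B. Fract (const3 (c (\<phi> b))) 1 * b) \<in> I" for c
        using r[unfolded indep_def, THEN spec[of _ "\<lambda>b. c (\<phi> b)"]] that by (rule mp)
      then show "indep (\<phi> ` I) (\<phi> ` B)"
        unfolding indep_def eq by blast
    qed
  qed
  have "{enat (card B) | B. finite B \<and> B \<subseteq> \<phi> ` R \<and> indep (\<phi> ` I) B} =
      {enat (card B) | B. finite B \<and> B \<subseteq> R \<and> indep I B}"
  proof (intro equalityI subsetI)
    fix x
    assume "x \<in> {enat (card B) | B. finite B \<and> B \<subseteq> \<phi> ` R \<and> indep (\<phi> ` I) B}"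
    then obtain B where B: "x = enat (card B)" "finite B" "B \<subseteq> \<phi> ` R" "indep (\<phi> ` I) B" by blast
    then obtain B' where B': "B' \<subseteq> R" "finite B'" "B = \<phi> ` B'" using finite_subset_image by blast
    with B have "x = enat (card B')" "indep I B'"
      by (simp_all add: card_image[OF inj_B] indep_image)
    with B' show "x \<in> {enat (card B) | B. finite B \<and> B \<subseteq> R \<and> indep I B}" by blast
  next
    fix x
    assume "x \<in> {enat (card B) | B. finite B \<and> B \<subseteq> R \<and> indep I B}"
    then obtain B where B: "x = enat (card B)" "finite B" "B \<subseteq> R" "indep I B" by blast
    then have "x = enat (card (\<phi> ` B))" "finite (\<phi> ` B)" "\<phi> ` B \<subseteq> \<phi> ` R" "indep (\<phi> ` I) (\<phi> ` B)"
      by (auto simp: card_image[OF inj_B] indep_image)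
    then show "x \<in> {enat (card B) | B. finite B \<and> B \<subseteq> \<phi> ` R \<and> indep (\<phi> ` I) B}" by blast
  qed
  then show ?thesis unfolding quotient_dim_def indep_def by simp
qed

text \<open>The action of \<open>A\<close> on the function field, read off an arbitrary
  representation as a fraction. For invertible \<open>A\<close> the choice does not matter, by the
  next lemma.\<close>

definition fract_subst3 :: "complex ^ 3 ^ 3 \<Rightarrow> poly3 fract \<Rightarrow> poly3 fract" where
  "fract_subst3 A q = (SOME r. \<exists>a b. b \<noteq> 0 \<and> q = Fract a b \<and> r = Fract (subst3 A a) (subst3 A b))"

text \<open>Invertibility keeps denominators nonzero, and a cross-multiplied equality of fractions
  survives substitution.\<close>

lemma fract_subst3_Fract:
  assumes A: "invertible A" and b: "b \<noteq> 0"
  shows "fract_subst3 A (Fract a b) = Fract (subst3 A a) (subst3 A b)"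
proof -
  have "\<exists>a' b'. b' \<noteq> 0 \<and> Fract a b = Fract a' b' \<and> fract_subst3 A (Fract a b) = Fract (subst3 A a') (subst3 A b')"
    unfolding fract_subst3_def by (rule someI_ex) (use b in blast)
  then obtain a' b' where *: "b' \<noteq> 0" "Fract a b = Fract a' b'"
    "fract_subst3 A (Fract a b) = Fract (subst3 A a') (subst3 A b')" by blast
  then have "a * b' = a' * b" using b by (simp add: eq_fract)
  then have "subst3 A a * subst3 A b' = subst3 A a' * subst3 A b" by (simp only: subst3_mult[symmetric])
  then show ?thesis using * b by (simp add: eq_fract subst3_eq_0_iff[OF A])
qed

lemma inj_fract_subst3:
  assumes A: "invertible A"
  shows "inj (fract_subst3 A)"
proof (rule injI)
  fix x y
  assume eq: "fract_subst3 A x = fract_subst3 A y"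
  obtain a b where x: "x = Fract a b" "b \<noteq> 0" by (cases x)
  obtain c d where y: "y = Fract c d" "d \<noteq> 0" by (cases y)
  have "subst3 A (a * d) = subst3 A (c * b)"
    using eq x y by (simp add: fract_subst3_Fract[OF A] eq_fract subst3_eq_0_iff[OF A] subst3_mult)
  then have "a * d = c * b" using subst3_eq_iff[OF A] by blast
  then show "x = y" using x y by (simp add: eq_fract)
qed

lemma fract_subst3_add:
  assumes A: "invertible A"
  shows "fract_subst3 A (x + y) = fract_subst3 A x + fract_subst3 A y"
proof -
  obtain a b where x: "x = Fract a b" "b \<noteq> 0" by (cases x)
  obtain c d where y: "y = Fract c d" "d \<noteq> 0" by (cases y)
  show ?thesis
    using x y by (simp add: fract_subst3_Fract[OF A] subst3_eq_0_iff[OF A] subst3_mult subst3_add)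
qed

lemma fract_subst3_scale:
  assumes A: "invertible A"
  shows "fract_subst3 A (Fract (const3 c) 1 * x) = Fract (const3 c) 1 * fract_subst3 A x"
proof -
  obtain a b where x: "x = Fract a b" "b \<noteq> 0" by (cases x)
  then show ?thesis
    by (simp add: fract_subst3_Fract[OF A] subst3_mult subst3_const3)
qed

lemma local_idealI:
  "homogeneous k a \<Longrightarrow> homogeneous k b \<Longrightarrow> f dvd a \<Longrightarrow> eval3 b v \<noteq> 0 \<Longrightarrow> Fract a b \<in> local_ideal f v"
  unfolding local_ideal_def by blast

text \<open>Lets the transport of ideals also cover the local ring itself.\<close>

lemma local_ideal_1: "local_ideal 1 v = local_ring v"
  by (simp add: local_ideal_def local_ring_def)

text \<open>Substitution preserves degrees and divisibility, and the value of a denominator at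
  \<open>A *v v\<close> becomes that of its pullback at \<open>v\<close>. The reverse inclusion uses
  the inverse matrix.\<close>

lemma fract_subst3_local_ideal:
  assumes A: "invertible A"
  shows "fract_subst3 A ` local_ideal f (A *v v) = local_ideal (subst3 A f) v"
proof (intro equalityI subsetI)
  fix x
  assume "x \<in> fract_subst3 A ` local_ideal f (A *v v)"
  then obtain a b k where *: "x = fract_subst3 A (Fract a b)" "homogeneous k a" "homogeneous k b" "f dvd a"
    "eval3 b (A *v v) \<noteq> 0"
    unfolding local_ideal_def by blast
  then have "b \<noteq> 0" by auto
  then have x: "x = Fract (subst3 A a) (subst3 A b)" using * by (simp add: fract_subst3_Fract[OF A])
  show "x \<in> local_ideal (subst3 A f) v"
    unfolding x by (rule local_idealI[of k]) (use * in \<open>simp_all add: homogeneous_subst3 subst3_dvd_iff[OF A]\<close>)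
next
  fix x
  assume "x \<in> local_ideal (subst3 A f) v"
  then obtain a b k where *: "x = Fract a b" "homogeneous k a" "homogeneous k b" "subst3 A f dvd a"
    "eval3 b v \<noteq> 0"
    unfolding local_ideal_def by blast
  obtain B where B: "invertible B" "\<And>f. subst3 A (subst3 B f) = f"
    using subst3_inverse[OF A] by blast
  have "b \<noteq> 0" using * by auto
  then have "subst3 B b \<noteq> 0" using B by (simp add: subst3_eq_0_iff)
  then have x: "x = fract_subst3 A (Fract (subst3 B a) (subst3 B b))"
    using * B by (simp add: fract_subst3_Fract[OF A])
  have "eval3 (subst3 B b) (A *v v) \<noteq> 0"
    using *(5) eval3_subst3[of A "subst3 B b" v] B(2)[of b] by metis
  moreover have "f dvd subst3 B a"
    using *(4) subst3_dvd_iff[OF A, of f "subst3 B a"] by (simp only: B)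
  ultimately have "Fract (subst3 B a) (subst3 B b) \<in> local_ideal f (A *v v)"
    using local_idealI[OF *(2,3)[THEN homogeneous_subst3]] by blast
  with x show "x \<in> fract_subst3 A ` local_ideal f (A *v v)" by (rule image_eqI)
qed

lemma fract_subst3_local_ring:
  assumes "invertible A"
  shows "fract_subst3 A ` local_ring (A *v v) = local_ring v"
  using fract_subst3_local_ideal[OF assms, of 1 v] by (simp add: local_ideal_1 subst3_1)

lemma curve_rel_refl: "f \<noteq> 0 \<Longrightarrow> k \<ge> 1 \<Longrightarrow> homogeneous k f \<Longrightarrow> curve_rel f f"
  unfolding curve_rel_def using const3_1 by (metis mult_1 one_neq_zero)

lemma proj_rel_refl: "v \<noteq> 0 \<Longrightarrow> proj_rel v v"
  unfolding proj_rel_def by (metis one_neq_zero vector_smult_lid)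

lemma curve_rel_subst3:
  assumes "invertible A" "curve_rel f f"
  shows "curve_rel (subst3 A f) (subst3 A f)"
proof -
  obtain k where "f \<noteq> 0" "k \<ge> 1" "homogeneous k f" using assms(2) unfolding curve_rel_def by blast
  then show ?thesis
    using subst3_eq_0_iff[OF assms(1)] homogeneous_subst3 by (intro curve_rel_refl[of _ k]) simp_all
qed

text \<open>\<open>fract_subst3 A\<close> carries the local ring at \<open>A *v v\<close>, and the
  sum of the two ideals in it, to their counterparts at \<open>v\<close>.\<close>

lemma intersection_mult_subst3:
  assumes A: "invertible A" and f: "curve_rel f f" and h: "curve_rel h h" and v: "v \<noteq> 0"
  shows "intersection_mult (abs_plane_curve (subst3 A f)) (abs_plane_curve (subst3 A h)) (abs_proj_plane v) =
    intersection_mult (abs_plane_curve f) (abs_plane_curve h) (abs_proj_plane (A *v v))"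
proof -
  have "A *v v \<noteq> 0" using v A by (metis invertible_def matrix_vector_mul_assoc matrix_vector_mul_lid matrix_vector_mult_0_right)
  note rel = this[THEN proj_rel_refl] v[THEN proj_rel_refl] f h curve_rel_subst3[OF A f] curve_rel_subst3[OF A h]
  define \<phi> where "\<phi> = fract_subst3 A"
  have add: "\<phi> (x + y) = \<phi> x + \<phi> y" for x y by (simp add: \<phi>_def fract_subst3_add[OF A])
  have image_sum: "\<phi> ` {a + b | a b. a \<in> X \<and> b \<in> Y} = {a + b | a b. a \<in> \<phi> ` X \<and> b \<in> \<phi> ` Y}" for X Y
  proof (intro equalityI subsetI)
    fix x
    assume "x \<in> \<phi> ` {a + b | a b. a \<in> X \<and> b \<in> Y}"
    then obtain a b where "a \<in> X" "b \<in> Y" "x = \<phi> (a + b)" by blast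
    then show "x \<in> {a + b | a b. a \<in> \<phi> ` X \<and> b \<in> \<phi> ` Y}" unfolding add by blast
  next
    fix x
    assume "x \<in> {a + b | a b. a \<in> \<phi> ` X \<and> b \<in> \<phi> ` Y}"
    then obtain a b where "a \<in> X" "b \<in> Y" "x = \<phi> a + \<phi> b" by blast
    then show "x \<in> \<phi> ` {a + b | a b. a \<in> X \<and> b \<in> Y}" unfolding add[symmetric] by blast
  qed
  have dim: "quotient_dim (\<phi> ` R) (\<phi> ` I) = quotient_dim R I" for R I
    unfolding \<phi>_def
    by (rule quotient_dim_image[OF inj_fract_subst3[OF A] fract_subst3_add[OF A] fract_subst3_scale[OF A]])
  show ?thesis
    unfolding intersection_mult.abs_eq[OF rel(5,6,2)] intersection_mult.abs_eq[OF rel(3,4,1)]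
    unfolding fract_subst3_local_ideal[OF A, folded \<phi>_def, symmetric]
    unfolding fract_subst3_local_ring[OF A, of v, folded \<phi>_def, symmetric] image_sum[symmetric] dim ..
qed

section \<open>Exchanging a component of a curve\<close>

lemma local_ideal_add:
  assumes "x \<in> local_ideal f v" "y \<in> local_ideal f v"
  shows "x + y \<in> local_ideal f v"
proof -
  obtain a b k where x: "x = Fract a b" "homogeneous k a" "homogeneous k b" "f dvd a" "eval3 b v \<noteq> 0"
    using assms(1) unfolding local_ideal_def by blast
  obtain c d j where y: "y = Fract c d" "homogeneous j c" "homogeneous j d" "f dvd c" "eval3 d v \<noteq> 0"
    using assms(2) unfolding local_ideal_def by blast
  have "b \<noteq> 0" "d \<noteq> 0" using x y by auto
  then have xy: "x + y = Fract (a * d + c * b) (b * d)" using x y by simp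
  have "homogeneous (k + j) (a * d)" "homogeneous (j + k) (c * b)" "homogeneous (k + j) (b * d)"
    using x y by (auto intro: homogeneous_mult)
  then have "homogeneous (k + j) (a * d + c * b)" "homogeneous (k + j) (b * d)"
    by (auto intro: homogeneous_add simp: add.commute)
  then show ?thesis
    unfolding xy by (rule local_idealI) (use x y in simp_all)
qed

text \<open>\<open>G\<close> is a unit at \<open>v\<close>, so \<open>m\<close> is congruent to
  \<open>H / G\<close> times \<open>l\<close> modulo \<open>f\<close>. Homogeneity is required of
  the products \<open>K * f\<close> and \<open>H * l\<close> because \<open>K\<close> is 0 in one
  application and \<open>H\<close> is controlled only through such a product in the other.\<close>

lemma local_ideal_exchange:
  assumes G: "homogeneous r G" "eval3 G v \<noteq> 0" and m: "homogeneous s m" "m \<noteq> 0"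
    and Kf: "homogeneous (r + s) (K * f)" and Hl: "homogeneous (r + s) (H * l)"
    and eq: "G * m = K * f + H * l"
  shows "{a + b | a b. a \<in> local_ideal f v \<and> b \<in> local_ideal (m * h) v} \<subseteq>
    {a + b | a b. a \<in> local_ideal f v \<and> b \<in> local_ideal (l * h) v}"
proof clarify
  fix x y
  assume x: "x \<in> local_ideal f v" and "y \<in> local_ideal (m * h) v"
  then obtain a b k where y: "y = Fract a b" "homogeneous k a" "homogeneous k b" "m * h dvd a" "eval3 b v \<noteq> 0"
    unfolding local_ideal_def by blast
  then obtain e where e: "a = m * (h * e)" by (auto simp: dvd_def mult.assoc)
  \<comment> \<open>\<open>a = m * (h * e)\<close> has degree \<open>k\<close>, so the cofactor
    \<open>h * e\<close>, unless 0, is homogeneous of degree \<open>k - s\<close>.\<close>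
  have hom: "homogeneous (r + k) (K * f * (h * e))" "homogeneous (r + k) (H * l * (h * e))"
  proof -
    have "homogeneous (r + k) (P * (h * e))" if "homogeneous (r + s) P" for P
    proof (cases "h * e = 0")
      case False
      then obtain j where "k = s + j" "homogeneous j (h * e)"
        using homogeneous_factor[OF m, of k "h * e"] y(2) e by blast
      with homogeneous_mult[OF that this(2)] show ?thesis by (simp add: add.assoc)
    qed (simp only: mult_zero_right homogeneous_0)
    then show "homogeneous (r + k) (K * f * (h * e))" "homogeneous (r + k) (H * l * (h * e))"
      using Kf Hl by blast+
  qed
  \<comment> \<open>Expanding \<open>a / b\<close> by \<open>G\<close> and inserting the relation
    splits it into a multiple of \<open>f\<close> and a multiple of \<open>l * h\<close>.\<close>
  define y1 y2 where "y1 = Fract (K * f * (h * e)) (G * b)" and "y2 = Fract (H * l * (h * e)) (G * b)"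
  have Gb: "homogeneous (r + k) (G * b)" "eval3 (G * b) v \<noteq> 0" using G y by (auto intro: homogeneous_mult)
  then have "G * b \<noteq> 0" by auto
  have "y1 + y2 = Fract ((G * m) * (h * e)) (G * b)"
    using \<open>G * b \<noteq> 0\<close> unfolding eq y1_def y2_def by (simp add: eq_fract algebra_simps)
  also have "\<dots> = y" using \<open>G * b \<noteq> 0\<close> by (simp add: y(1) e eq_fract algebra_simps)
  finally have y12: "y1 + y2 = y" .
  have "y1 \<in> local_ideal f v"
    unfolding y1_def by (rule local_idealI[OF hom(1) Gb(1) _ Gb(2)]) simp
  moreover have "y2 \<in> local_ideal (l * h) v"
    unfolding y2_def by (rule local_idealI[OF hom(2) Gb(1) _ Gb(2)]) (simp add: mult_dvd_mono)
  ultimately have "x + y1 \<in> local_ideal f v" "y2 \<in> local_ideal (l * h) v"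
    using local_ideal_add[OF x] by blast+
  then show "\<exists>a b. x + y = a + b \<and> a \<in> local_ideal f v \<and> b \<in> local_ideal (l * h) v"
    by (intro exI[of _ "x + y1"] exI[of _ y2]) (simp add: add.assoc y12)
qed

section \<open>Restriction to a line\<close>

definition line_poly :: "poly3 \<Rightarrow> complex ^ 3 \<Rightarrow> complex ^ 3 \<Rightarrow> complex poly" where
  "line_poly f a b = (\<Sum>m\<in>Poly_Mapping.keys f.
    [:Poly_Mapping.lookup f m:] * (\<Prod>i\<in>UNIV. [:a $ i, b $ i:] ^ Poly_Mapping.lookup m i))"

lemma poly_line_poly: "poly (line_poly f a b) t = eval3 f (a + t *s b)"
  by (simp add: line_poly_def eval3_def poly_sum poly_prod)

text \<open>Only the coordinates that vary along the line count. On a line parallel to an axis this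
  is the degree in a single variable.\<close>

lemma degree_line_poly_le:
  assumes "\<And>m. m \<in> Poly_Mapping.keys f \<Longrightarrow> (\<Sum>i\<in>UNIV. if b $ i = 0 then 0 else Poly_Mapping.lookup m i) \<le> N"
  shows "degree (line_poly f a b) \<le> N"
  unfolding line_poly_def
proof (rule degree_sum_le)
  fix m
  assume m: "m \<in> Poly_Mapping.keys f"
  have "degree ([:a $ i, b $ i:] ^ Poly_Mapping.lookup m i) \<le> (if b $ i = 0 then 0 else Poly_Mapping.lookup m i)" for i
    using degree_power_le[of "[:a $ i, b $ i:]" "Poly_Mapping.lookup m i"] by auto
  then have "degree (\<Prod>i\<in>UNIV. [:a $ i, b $ i:] ^ Poly_Mapping.lookup m i) \<le>
      (\<Sum>i\<in>UNIV. if b $ i = 0 then 0 else Poly_Mapping.lookup m i)"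
    by (intro order_trans[OF degree_prod_sum_le]) (auto intro: sum_mono)
  also have "\<dots> \<le> N" by (rule assms[OF m])
  finally show "degree ([:Poly_Mapping.lookup f m:] * (\<Prod>i\<in>UNIV. [:a $ i, b $ i:] ^ Poly_Mapping.lookup m i)) \<le> N"
    using degree_mult_le[of "[:Poly_Mapping.lookup f m:]" "\<Prod>i\<in>UNIV. [:a $ i, b $ i:] ^ Poly_Mapping.lookup m i"]
    by simp
qed simp

lemma degree_line_poly_homogeneous:
  assumes "homogeneous n f"
  shows "degree (line_poly f a b) \<le> n"
proof (rule degree_line_poly_le)
  fix m
  assume "m \<in> Poly_Mapping.keys f"
  then have "mdeg m = n" using assms by (simp add: homogeneous_def)
  moreover have "(\<Sum>i\<in>UNIV. if b $ i = 0 then 0 else Poly_Mapping.lookup m i) \<le> mdeg m"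
    by (rule sum_mono) simp
  ultimately show "(\<Sum>i\<in>UNIV. if b $ i = 0 then 0 else Poly_Mapping.lookup m i) \<le> n" by simp
qed

section \<open>The Fermat polynomial\<close>

definition fermat_poly :: "nat \<Rightarrow> poly3" where
  "fermat_poly d = (\<Sum>i\<in>UNIV. var3 i ^ d)"

lemma fermat_curve_fermat_poly: "fermat_curve d = abs_plane_curve (fermat_poly d)"
  by (simp add: fermat_curve_def fermat_poly_def sum_3)

lemma eval3_fermat_poly: "eval3 (fermat_poly d) v = (\<Sum>i\<in>UNIV. v $ i ^ d)"
  by (simp add: fermat_poly_def)

lemma homogeneous_fermat_poly: "homogeneous d (fermat_poly d)"
  unfolding fermat_poly_def using homogeneous_power[OF homogeneous_var3] by (intro homogeneous_sum) simp

text \<open>Excluding \<open>k = 0\<close> matters because \<open>0 ^ 0 = 1\<close>.\<close>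

lemma sum_mult_axis_power:
  assumes "k \<ge> 1"
  shows "(\<Sum>i\<in>UNIV. u $ i * (axis j 1 :: complex ^ 3) $ i ^ k) = u $ j"
proof -
  have "(\<Sum>i\<in>UNIV. u $ i * (axis j 1 :: complex ^ 3) $ i ^ k) = (\<Sum>i\<in>UNIV. if i = j then u $ j else 0)"
    by (rule sum.cong) (use assms in \<open>auto simp: axis_def\<close>)
  then show ?thesis by simp
qed

lemma fermat_poly_nonzero:
  assumes "d \<ge> 1"
  shows "fermat_poly d \<noteq> 0"
proof -
  have "eval3 (fermat_poly d) (axis 1 1) = 1"
    using sum_mult_axis_power[OF assms, of 1 1] by (simp add: eval3_fermat_poly)
  then show ?thesis by auto
qed

lemma var3_power: "var3 i ^ k = Poly_Mapping.single (Poly_Mapping.single i k) 1"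
  by (induction k) (simp_all add: var3_def mult_single flip: single_add)

text \<open>After a multiple of the Fermat polynomial is subtracted, the degree in the last variable is
  less than \<open>d\<close>, while there are \<open>d\<close> zeros on a general vertical line.\<close>

lemma fermat_nullstellensatz:
  assumes d: "d \<ge> 1" and h: "homogeneous d h"
    and zero: "\<And>v. eval3 (fermat_poly d) v = 0 \<Longrightarrow> eval3 h v = 0"
  shows "\<exists>c. h = const3 c * fermat_poly d"
proof -
  \<comment> \<open>The coefficient of \<open>z^d\<close> in the Fermat polynomial is 1, so
    subtracting this multiple removes \<open>z^d\<close> from \<open>h\<close>.\<close>
  define c where "c = Poly_Mapping.lookup h (Poly_Mapping.single 3 d)"
  define r where "r = h - const3 c * fermat_poly d"
  have inj: "Poly_Mapping.single i d = Poly_Mapping.single j d \<longleftrightarrow> i = j" for i j :: 3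
    using d by (metis lookup_single_eq lookup_single_not_eq not_one_le_zero)
  have "Poly_Mapping.lookup (fermat_poly d) (Poly_Mapping.single 3 d) = (\<Sum>i\<in>UNIV. if i = (3::3) then 1 else 0)"
    unfolding fermat_poly_def lookup_sum var3_power by (rule sum.cong) (auto simp: lookup_single when_def inj)
  then have r0: "Poly_Mapping.lookup r (Poly_Mapping.single 3 d) = 0"
    by (simp add: r_def c_def lookup_minus lookup_const3_mult)
  have hom: "homogeneous d r"
    unfolding r_def by (intro homogeneous_diff h homogeneous_cmult homogeneous_fermat_poly)
  have r_zero: "eval3 r v = 0" if "eval3 (fermat_poly d) v = 0" for v
    using that zero by (simp add: r_def)
  have "r = 0"
  proof (rule ccontr)
    assume "r \<noteq> 0"
    \<comment> \<open>The vertical line is taken through a point where \<open>r\<close> is nonzero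
      and \<open>x^d + y^d\<close> is nonzero; the latter makes its \<open>d\<close> intersections
      with the curve distinct.\<close>
    have "eval3 (var3 1 ^ d + var3 2 ^ d) (axis 1 1) = 1"
      using d by (simp add: axis_def)
    then have "var3 1 ^ d + var3 2 ^ d \<noteq> 0" by (metis eval3_0 zero_neq_one)
    with \<open>r \<noteq> 0\<close> obtain v where v: "eval3 r v \<noteq> 0" "v $ 1 ^ d + v $ 2 ^ d \<noteq> 0"
      using eval3_nonzero[of "r * (var3 1 ^ d + var3 2 ^ d)"] by auto
    define a b where "a = (vector [v $ 1, v $ 2, 0] :: complex ^ 3)" and "b = (axis 3 1 :: complex ^ 3)"
    define p where "p = line_poly r a b"
    have nth: "(a + t *s b) $ 1 = v $ 1" "(a + t *s b) $ 2 = v $ 2" "(a + t *s b) $ 3 = t" for t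
      by (simp_all add: a_def b_def axis_def)
    have "v = a + v $ 3 *s b"
      unfolding vec_eq_iff forall_3 nth by simp
    then have "poly p (v $ 3) = eval3 r v" by (simp add: p_def poly_line_poly)
    with v have "p \<noteq> 0" by auto
    have "degree p \<le> d - 1"
      unfolding p_def
    proof (rule degree_line_poly_le)
      fix m
      assume m: "m \<in> Poly_Mapping.keys r"
      then have sum: "Poly_Mapping.lookup m 1 + Poly_Mapping.lookup m 2 + Poly_Mapping.lookup m 3 = d"
        using hom by (simp add: homogeneous_def sum_3)
      have "Poly_Mapping.lookup m 3 \<noteq> d"
      proof
        assume "Poly_Mapping.lookup m 3 = d"
        with sum have "\<forall>i. Poly_Mapping.lookup m i = Poly_Mapping.lookup (Poly_Mapping.single 3 d) i"
          unfolding forall_3 by (simp add: lookup_single)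
        then have "m = Poly_Mapping.single 3 d" by (simp add: poly_mapping_eqI)
        with m r0 show False by (simp add: in_keys_iff)
      qed
      with sum show "(\<Sum>i\<in>UNIV. if b $ i = 0 then 0 else Poly_Mapping.lookup m i) \<le> d - 1"
        unfolding sum_3 by (simp add: b_def axis_def)
    qed
    have "{t. t ^ d = - (v $ 1 ^ d + v $ 2 ^ d)} \<subseteq> {t. poly p t = 0}"
      by (auto simp: p_def poly_line_poly eval3_fermat_poly sum_3 nth simp del: vector_add_component intro!: r_zero)
    moreover have "finite {t. poly p t = 0}" using \<open>p \<noteq> 0\<close> by (rule poly_roots_finite)
    ultimately have "card {t. t ^ d = - (v $ 1 ^ d + v $ 2 ^ d)} \<le> card {t. poly p t = 0}"
      by (rule card_mono[rotated])
    also have "\<dots> \<le> degree p" using \<open>p \<noteq> 0\<close> by (rule card_poly_roots_bound)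
    also have "\<dots> \<le> d - 1" by fact
    finally have "card {t. t ^ d = - (v $ 1 ^ d + v $ 2 ^ d)} \<le> d - 1" .
    moreover have "card {t. t ^ d = - (v $ 1 ^ d + v $ 2 ^ d)} = d"
      using v(2) d by (intro card_nth_roots) (metis neg_equal_0_iff_equal, simp)
    ultimately show False using d by linarith
  qed
  then show ?thesis by (auto simp: r_def)
qed

section \<open>Coordinates adapted to a line\<close>

lemma exists_bil3_eq_0: "\<exists>a. a \<noteq> 0 \<and> bil3 l a = 0"
proof (cases "l $ 1 = 0")
  case True
  then show ?thesis by (intro exI[of _ "axis 1 1"]) (simp add: bil3_axis axis_eq_0_iff)
next
  case False
  have "bil3 l (vector [l $ 2, - l $ 1, 0]) = 0" by (simp add: bil3_def sum_3)
  moreover have "(vector [l $ 2, - l $ 1, 0] :: complex ^ 3) $ 2 \<noteq> 0" using False by simp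
  ultimately show ?thesis by (intro exI[of _ "vector [l $ 2, - l $ 1, 0]"]) (auto simp del: vector_3)
qed

text \<open>A basis \<open>a\<close>, \<open>b\<close>, \<open>e\<close> with dual basis
  \<open>s\<close>, \<open>t\<close>, \<open>l\<close>: the first two vectors span the line
  \<open>l = 0\<close>, and \<open>e\<close> lies off it.\<close>

definition line_coords :: "complex ^ 3 \<Rightarrow> complex ^ 3 \<Rightarrow> complex ^ 3 \<Rightarrow> complex ^ 3 \<Rightarrow> complex ^ 3 \<Rightarrow> complex ^ 3 \<Rightarrow> bool" where
  "line_coords l a b e s t \<longleftrightarrow>
    bil3 s a = 1 \<and> bil3 s b = 0 \<and> bil3 s e = 0 \<and>
    bil3 t a = 0 \<and> bil3 t b = 1 \<and> bil3 t e = 0 \<and>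
    bil3 l a = 0 \<and> bil3 l b = 0 \<and> bil3 l e = 1 \<and>
    (\<forall>v. v = bil3 s v *s a + bil3 t v *s b + bil3 l v *s e)"

lemma line_coords_exist:
  assumes "a \<noteq> 0" "l \<noteq> 0" "bil3 l a = 0"
  shows "\<exists>b e s t. line_coords l a b e s t"
proof -
  obtain k where k: "l $ k \<noteq> 0" using assms(2) by (auto simp: vec_eq_iff)
  obtain j where j: "a $ j \<noteq> 0" using assms(1) by (auto simp: vec_eq_iff)
  define e where "e = inverse (l $ k) *s (axis k 1 :: complex ^ 3)"
  have le: "bil3 l e = 1" using k by (simp add: e_def bil3_scale bil3_axis)
  \<comment> \<open>Scaled to be 1 at \<open>a\<close>; the multiple of \<open>l\<close> corrects
    the value at \<open>e\<close> to 0.\<close>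
  define s where "s = inverse (a $ j) *s (axis j 1 - e $ j *s l)"
  have s: "bil3 s v = inverse (a $ j) * (v $ j - e $ j * bil3 l v)" for v
    by (simp only: bil3_commute[of _ v] s_def bil3_diff bil3_scale bil3_axis)
  have sa: "bil3 s a = 1" "bil3 s e = 0" using j assms(3) le by (simp_all add: s)
  define cross where "cross x y = (vector [x $ 2 * y $ 3 - x $ 3 * y $ 2, x $ 3 * y $ 1 - x $ 1 * y $ 3,
    x $ 1 * y $ 2 - x $ 2 * y $ 1] :: complex ^ 3)" for x y :: "complex ^ 3"
  have cross: "bil3 x (cross x y) = 0" "bil3 y (cross x y) = 0"
    "bil3 (cross x y) x = 0" "bil3 (cross x y) y = 0"
    "bil3 (cross x y) (cross z w) = bil3 x z * bil3 y w - bil3 x w * bil3 y z" for x y z w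
    by (simp_all add: bil3_def cross_def sum_3 algebra_simps)
  \<comment> \<open>Orthogonality of cross products gives the required zeros, and the Binet-Cauchy
    identity, the last fact on \<open>cross\<close>, gives \<open>bil3 t b = 1\<close>.\<close>
  define b t where "b = cross l s" and "t = cross e a"
  have "bil3 t b = bil3 e l * bil3 a s - bil3 e s * bil3 a l" by (simp add: b_def t_def cross)
  then have tb: "bil3 t b = 1" using le sa by (simp add: bil3_commute[of e] bil3_commute[of a])
  \<comment> \<open>\<open>P\<close> has the forms as rows and \<open>M\<close> the vectors as
    columns: \<open>P ** M = mat 1\<close> expresses duality and \<open>M ** P = mat 1\<close> the
    expansion of \<open>v\<close>.\<close>
  define P M where "P = (vector [s, t, l] :: complex ^ 3 ^ 3)"
    and "M = transpose (vector [a, b, e] :: complex ^ 3 ^ 3)"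
  have rels: "bil3 s b = 0" "bil3 l b = 0" "bil3 t a = 0" "bil3 t e = 0"
    by (simp_all add: b_def t_def cross)
  have PM: "(P ** M) $ i $ j = bil3 (P $ i) (transpose M $ j)" for i j
    by (simp add: matrix_matrix_mult_def bil3_def transpose_def)
  have "P ** M = mat 1"
    unfolding vec_eq_iff forall_3 PM
    using rels tb sa le assms(3) by (simp add: P_def M_def transpose_transpose mat_def)
  then have "M ** P = mat 1" by (simp add: matrix_left_right_inverse)
  then have "M *v (P *v v) = v" for v by (simp add: matrix_vector_mul_assoc)
  moreover have "(M *v w) $ i = a $ i * w $ 1 + b $ i * w $ 2 + e $ i * w $ 3" for w i
    by (simp add: matrix_vector_mult_def sum_3 M_def transpose_def)
  moreover have "(P *v v) $ 1 = bil3 s v" "(P *v v) $ 2 = bil3 t v" "(P *v v) $ 3 = bil3 l v" for v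
    by (simp_all add: matrix_vector_mult_nth P_def)
  ultimately have "v = bil3 s v *s a + bil3 t v *s b + bil3 l v *s e" for v
    by (metis (no_types, lifting) vec_eq_iff vector_add_component vector_smult_component mult.commute)
  then show ?thesis
    using rels tb sa le assms(3) unfolding line_coords_def
    by (intro exI[of _ b] exI[of _ e] exI[of _ s] exI[of _ t]) simp
qed

section \<open>A pointwise fixed line is transversal to the Fermat curve\<close>

text \<open>Up to the factor \<open>d\<close>, the derivative of the Fermat polynomial at \<open>v\<close> in direction \<open>w\<close>.\<close>

definition fermat_grad :: "nat \<Rightarrow> complex ^ 3 \<Rightarrow> complex ^ 3 \<Rightarrow> complex" where
  "fermat_grad d v w = (\<Sum>i\<in>UNIV. w $ i * v $ i ^ (d - 1))"

lemma fermat_grad_add: "fermat_grad d v (w + w') = fermat_grad d v w + fermat_grad d v w'"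
  by (simp add: fermat_grad_def ring_distribs sum.distrib)

lemma fermat_grad_scale: "fermat_grad d v (c *s w) = c * fermat_grad d v w"
  by (simp add: fermat_grad_def sum_distrib_left mult.assoc)

lemma fermat_grad_axis: "fermat_grad d v (axis i 1) = v $ i ^ (d - 1)"
proof -
  have "fermat_grad d v (axis i 1) = (\<Sum>j\<in>UNIV. if j = i then v $ i ^ (d - 1) else 0)"
    unfolding fermat_grad_def by (rule sum.cong) (auto simp: axis_def)
  then show ?thesis by simp
qed

lemma fermat_poly_deriv:
  "((\<lambda>t. eval3 (fermat_poly d) (v + t *s w)) has_field_derivative of_nat d * fermat_grad d v w) (at 0)"
proof -
  have "((\<lambda>t. \<Sum>i\<in>UNIV. (v $ i + t * w $ i) ^ d) has_field_derivative
      (\<Sum>i\<in>UNIV. of_nat d * ((v $ i + 0 * w $ i) ^ (d - 1) * w $ i))) (at 0)"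
    by (rule DERIV_sum) (auto intro!: derivative_eq_intros)
  then show ?thesis
    by (simp add: eval3_fermat_poly fermat_grad_def sum_distrib_left mult_ac)
qed

text \<open>Differentiate at \<open>t = 0\<close> and cancel \<open>d\<close>. The cases
  \<open>c = 0\<close> and \<open>w' = 0\<close> serve to show that derivatives vanish.\<close>

lemma fermat_grad_unique:
  assumes "d \<ge> 1" "\<And>t. eval3 (fermat_poly d) (v + t *s w) = c * eval3 (fermat_poly d) (v' + t *s w')"
  shows "fermat_grad d v w = c * fermat_grad d v' w'"
proof -
  have "((\<lambda>t. c * eval3 (fermat_poly d) (v' + t *s w')) has_field_derivative
      c * (of_nat d * fermat_grad d v' w')) (at 0)"
    by (intro DERIV_cmult fermat_poly_deriv)
  with fermat_poly_deriv[of d v w] have "of_nat d * fermat_grad d v w = c * (of_nat d * fermat_grad d v' w')"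
    unfolding assms(2) by (rule DERIV_unique)
  then show ?thesis using assms(1) by (simp add: mult.left_commute)
qed

text \<open>A gradient that vanishes on the line is a multiple of \<open>l\<close>; its value at
  \<open>e\<close>, where \<open>l\<close> is 1, is the factor.\<close>

lemma fermat_grad_tangent:
  assumes l: "line_coords l a b e s t" and zero: "\<And>w. bil3 l w = 0 \<Longrightarrow> fermat_grad d v w = 0"
  shows "fermat_grad d v w = bil3 l w * fermat_grad d v e"
proof -
  have "w = bil3 s w *s a + bil3 t w *s b + bil3 l w *s e" "bil3 l a = 0" "bil3 l b = 0"
    using l unfolding line_coords_def by blast+
  then have "fermat_grad d v w = fermat_grad d v (bil3 s w *s a + bil3 t w *s b + bil3 l w *s e)"
    "fermat_grad d v a = 0" "fermat_grad d v b = 0"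
    using zero by simp_all
  then show ?thesis by (simp add: fermat_grad_add fermat_grad_scale)
qed

text \<open>Smoothness of the Fermat curve: if the factor were 0, all partial derivatives at
  \<open>v\<close> would vanish.\<close>

lemma fermat_grad_tangent_nonzero:
  assumes l: "line_coords l a b e s t" and zero: "\<And>w. bil3 l w = 0 \<Longrightarrow> fermat_grad d v w = 0" and "v \<noteq> 0"
  shows "fermat_grad d v e \<noteq> 0"
proof
  assume "fermat_grad d v e = 0"
  then have "v $ i ^ (d - 1) = 0" for i
    using fermat_grad_tangent[OF l zero, of "axis i 1"] by (simp add: fermat_grad_axis)
  then have "v = 0" by (simp add: vec_eq_iff)
  with \<open>v \<noteq> 0\<close> show False by contradiction
qed

text \<open>If the curve contained the line, its gradient would be proportional to \<open>l\<close> along the line;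
  but the line meets each coordinate axis.\<close>

lemma fermat_contains_no_line:
  assumes d: "d \<ge> 2" and l: "line_coords l a b e s t"
  shows "\<exists>v. bil3 l v = 0 \<and> eval3 (fermat_poly d) v \<noteq> 0"
proof (rule ccontr)
  assume "\<not> ?thesis"
  then have zero: "eval3 (fermat_poly d) v = 0" if "bil3 l v = 0" for v using that by blast
  have grad: "fermat_grad d v w = 0" if "bil3 l v = 0" "bil3 l w = 0" for v w
    using fermat_grad_unique[of d v w 0 v w] d that by (simp add: zero bil3_add bil3_scale)
  have lc: "bil3 s a = 1" "bil3 t b = 1" "bil3 s b = 0" "bil3 l a = 0" "bil3 l b = 0" "bil3 l e = 1"
    using l unfolding line_coords_def by blast+
  have "l $ i = 0" for i
  proof -
    \<comment> \<open>A nonzero vector over the line with coordinate \<open>i\<close> equal to 0.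
      The derivative there in direction \<open>i\<close> vanishes, but it is also
      \<open>l $ i\<close> times a nonzero factor.\<close>
    define v where "v = (if a $ i = 0 then a else b $ i *s a - a $ i *s b)"
    have "v $ i = 0" by (simp add: v_def)
    have "bil3 l v = 0" using lc by (simp add: v_def bil3_diff bil3_scale)
    have "v \<noteq> 0"
    proof
      assume v: "v = 0"
      show False
      proof (cases "a $ i = 0")
        case True
        then have "bil3 s v = 1" using lc by (simp add: v_def)
        then show False by (simp add: v bil3_def)
      next
        case False
        have "bil3 t v = b $ i * bil3 t a - a $ i" using False lc by (simp add: v_def bil3_diff bil3_scale)
        also have "bil3 t a = 0" using l unfolding line_coords_def by blast
        finally show False using False by (simp add: v bil3_def)
      qed
    qed
    note grad_v = grad[OF \<open>bil3 l v = 0\<close>]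
    have "fermat_grad d v (axis i 1) = 0"
      using d \<open>v $ i = 0\<close> by (simp add: fermat_grad_axis)
    then have "bil3 l (axis i 1) * fermat_grad d v e = 0"
      using fermat_grad_tangent[OF l grad_v, of "axis i 1"] by simp
    then show ?thesis
      using fermat_grad_tangent_nonzero[OF l grad_v \<open>v \<noteq> 0\<close>] by (simp add: bil3_axis)
  qed
  then have "bil3 l e = 0" by (simp add: bil3_def)
  with lc show False by simp
qed

text \<open>An elation \<open>v \<mapsto> v + l(v) u\<close> with \<open>l(u) = 0\<close> has infinite order; if it preserved the Fermat
  polynomial, all partial derivatives in direction \<open>u\<close> would vanish.\<close>

lemma fermat_no_elation:
  assumes d: "d \<ge> 2" and "l \<noteq> 0" and lu: "bil3 l u = 0"
    and inv: "\<And>v. eval3 (fermat_poly d) (v + bil3 l v *s u) = eval3 (fermat_poly d) v"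
  shows "u = 0"
proof -
  have iter: "eval3 (fermat_poly d) (v + (of_nat k * bil3 l v) *s u) = eval3 (fermat_poly d) v" for v k
  proof (induction k)
    case (Suc k)
    define v' where "v' = v + (of_nat k * bil3 l v) *s u"
    have "bil3 l v' = bil3 l v" by (simp add: v'_def bil3_add bil3_scale lu)
    then have step: "v + (of_nat (Suc k) * bil3 l v) *s u = v' + bil3 l v' *s u"
      by (simp add: v'_def vec_eq_iff algebra_simps)
    show ?case unfolding step inv unfolding v'_def by (rule Suc.IH)
  qed simp
  \<comment> \<open>A polynomial in \<open>t\<close> that vanishes at all natural numbers is 0, so
    the powers of the elation extend to all complex \<open>t\<close>.\<close>
  have const: "eval3 (fermat_poly d) (v + (t * bil3 l v) *s u) = eval3 (fermat_poly d) v" for v t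
  proof -
    define p where "p = line_poly (fermat_poly d) v (bil3 l v *s u) - [:eval3 (fermat_poly d) v:]"
    have "range of_nat \<subseteq> {t. poly p t = 0}"
      by (auto simp: p_def poly_line_poly iter)
    moreover have "infinite (range (of_nat :: nat \<Rightarrow> complex))"
      by (rule range_inj_infinite) (rule inj_of_nat)
    ultimately have "infinite {t. poly p t = 0}" using finite_subset by blast
    then have "p = 0" using poly_roots_finite by blast
    then have "poly p t = 0" by simp
    then show ?thesis by (simp add: p_def poly_line_poly)
  qed
  have "bil3 l v * fermat_grad d v u = 0" for v
    using fermat_grad_unique[of d v "bil3 l v *s u" 1 v 0] d by (simp add: const fermat_grad_scale fermat_grad_def[of d v 0])
  \<comment> \<open>Since \<open>bil3 l v\<close> is 0 for some \<open>v\<close>, it is cancelled as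
    a polynomial and not pointwise.\<close>
  then have "lin3 l * (\<Sum>i\<in>UNIV. const3 (u $ i) * var3 i ^ (d - 1)) = 0"
    by (intro eval3_eqI) (simp add: fermat_grad_def)
  moreover obtain i where "l $ i \<noteq> 0" using \<open>l \<noteq> 0\<close> by (auto simp: vec_eq_iff)
  then have "eval3 (lin3 l) (axis i 1) \<noteq> 0" by (simp add: bil3_axis)
  then have "lin3 l \<noteq> 0" by (metis eval3_0)
  ultimately have "(\<Sum>i\<in>UNIV. const3 (u $ i) * var3 i ^ (d - 1)) = 0" by simp
  then have "eval3 (\<Sum>i\<in>UNIV. const3 (u $ i) * var3 i ^ (d - 1)) (axis j 1) = eval3 0 (axis j 1)" for j
    by (simp only:)
  then have "(\<Sum>i\<in>UNIV. u $ i * (axis j 1 :: complex ^ 3) $ i ^ (d - 1)) = 0" for j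
    by (simp only: eval3_sum eval3_mult eval3_power eval3_var3 eval3_const3 eval3_0)
  then have "u $ j = 0" for j
    using sum_mult_axis_power[of "d - 1" u j] d by simp
  then show ?thesis by (simp add: vec_eq_iff)
qed

text \<open>Suppose that the gradient at \<open>v0\<close> is a multiple of \<open>l\<close>.
  Differentiating the invariance in direction \<open>e\<close>, which the map sends to
  \<open>e + u\<close>, yields \<open>c = 1 + bil3 l u\<close>. If \<open>c = 1\<close>, the map is
  an elation, which \<open>fermat_no_elation\<close> excludes. Otherwise the invariance along the
  line, where the map is the identity, forces \<open>F\<close> to vanish on all of it.\<close>

lemma fermat_axis_transversal:
  assumes d: "d \<ge> 2" and l: "line_coords l a b e s t" and "u \<noteq> 0" and "v0 \<noteq> 0" "bil3 l v0 = 0"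
    and inv: "\<And>v. eval3 (fermat_poly d) (v + bil3 l v *s u) = c * eval3 (fermat_poly d) v"
  shows "\<exists>w. bil3 l w = 0 \<and> fermat_grad d v0 w \<noteq> 0"
proof (rule ccontr)
  assume "\<not> ?thesis"
  then have zero: "\<And>w. bil3 l w = 0 \<Longrightarrow> fermat_grad d v0 w = 0" by blast
  note tangent = fermat_grad_tangent[OF l zero]
  have nz: "fermat_grad d v0 e \<noteq> 0" by (rule fermat_grad_tangent_nonzero[OF l zero \<open>v0 \<noteq> 0\<close>])
  have le: "bil3 l e = 1" using l unfolding line_coords_def by blast
  have "v0 + x *s (e + u) = (v0 + x *s e) + bil3 l (v0 + x *s e) *s u" for x
    using le \<open>bil3 l v0 = 0\<close> by (simp add: bil3_add bil3_scale vec_eq_iff algebra_simps)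
  then have "eval3 (fermat_poly d) (v0 + x *s (e + u)) = c * eval3 (fermat_poly d) (v0 + x *s e)" for x
    by (simp only: inv)
  then have "fermat_grad d v0 (e + u) = c * fermat_grad d v0 e"
    using fermat_grad_unique[of d] d by simp
  then have "(1 + bil3 l u) * fermat_grad d v0 e = c * fermat_grad d v0 e"
    using tangent[of u] by (simp add: fermat_grad_add algebra_simps)
  then have c: "c = 1 + bil3 l u" using nz by simp
  show False
  proof (cases "c = 1")
    case True
    have "l \<noteq> 0" using le by (auto simp: bil3_def)
    have "u = 0" by (rule fermat_no_elation[OF d \<open>l \<noteq> 0\<close>]) (use c True inv in simp_all)
    with \<open>u \<noteq> 0\<close> show False by contradiction
  next
    case False
    obtain v where v: "bil3 l v = 0" "eval3 (fermat_poly d) v \<noteq> 0"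
      using fermat_contains_no_line[OF d l] by blast
    then show False using inv[of v] False by simp
  qed
qed

text \<open>Expanded in the coordinates \<open>s\<close>, \<open>t\<close>, \<open>l\<close>, the
  polynomial \<open>F\<close> has no pure power of \<open>s\<close>, because \<open>F\<close>
  vanishes at \<open>a\<close>; so it lies in the ideal of \<open>t\<close> and \<open>l\<close>.
  The cofactor \<open>G\<close> of \<open>t\<close> takes at \<open>a\<close> the value of the
  derivative in direction \<open>b\<close>, so transversality makes it a unit there.\<close>

lemma fermat_line_exchange:
  assumes d: "d \<ge> 1" and l: "line_coords l a b e s t"
    and zero: "eval3 (fermat_poly d) a = 0" and grad: "fermat_grad d a b \<noteq> 0"
  shows "\<exists>G H. G * lin3 t = fermat_poly d + H * lin3 l \<and> homogeneous (d - 1) G \<and> eval3 G a \<noteq> 0 \<and>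
    homogeneous d (H * lin3 l)"
proof -
  \<comment> \<open>\<open>A i\<close> is the coordinate \<open>i\<close> without its
    \<open>l\<close> part. \<open>k i\<close> and \<open>g i\<close> are the cofactors in the
    differences of powers when passing from \<open>var3 i\<close> to \<open>A i\<close>, and from
    there to \<open>const3 (a $ i) * lin3 s\<close>.\<close>
  define A where "A i = const3 (a $ i) * lin3 s + const3 (b $ i) * lin3 t" for i
  define g where "g i = (\<Sum>j<d. (const3 (a $ i) * lin3 s) ^ (d - Suc j) * A i ^ j)" for i
  define k where "k i = (\<Sum>j<d. A i ^ (d - Suc j) * var3 i ^ j)" for i
  define G H where "G = (\<Sum>i\<in>UNIV. const3 (b $ i) * g i)" and "H = - (\<Sum>i\<in>UNIV. const3 (e $ i) * k i)"
  have lc: "bil3 s a = 1" "bil3 t a = 0" "v = bil3 s v *s a + bil3 t v *s b + bil3 l v *s e" for v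
    using l unfolding line_coords_def by blast+
  have var: "var3 i = A i + const3 (e $ i) * lin3 l" for i
  proof (rule eval3_eqI)
    fix v
    have "v $ i = (bil3 s v *s a + bil3 t v *s b + bil3 l v *s e) $ i" using lc(3)[of v] by simp
    then show "eval3 (var3 i) v = eval3 (A i + const3 (e $ i) * lin3 l) v" by (simp add: A_def mult.commute)
  qed
  have "(\<Sum>i\<in>UNIV. (const3 (a $ i) * lin3 s) ^ d) = 0"
  proof (rule eval3_eqI)
    fix v
    have "(\<Sum>i\<in>UNIV. (a $ i * bil3 s v) ^ d) = (\<Sum>i\<in>UNIV. a $ i ^ d) * bil3 s v ^ d"
      by (simp add: power_mult_distrib sum_distrib_right)
    then show "eval3 (\<Sum>i\<in>UNIV. (const3 (a $ i) * lin3 s) ^ d) v = eval3 0 v"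
      using zero by (simp add: eval3_fermat_poly)
  qed
  moreover have "var3 i ^ d = (const3 (a $ i) * lin3 s) ^ d + const3 (b $ i) * g i * lin3 t + const3 (e $ i) * k i * lin3 l" for i
  proof -
    have "var3 i ^ d - A i ^ d = (var3 i - A i) * k i"
      unfolding k_def by (rule power_diff_sumr2)
    moreover have "A i ^ d - (const3 (a $ i) * lin3 s) ^ d = (A i - const3 (a $ i) * lin3 s) * g i"
      unfolding g_def by (rule power_diff_sumr2)
    moreover have "var3 i - A i = const3 (e $ i) * lin3 l" by (subst var) simp
    moreover have "A i - const3 (a $ i) * lin3 s = const3 (b $ i) * lin3 t" by (simp add: A_def)
    ultimately show ?thesis by (simp add: algebra_simps)
  qed
  ultimately have "fermat_poly d = G * lin3 t - H * lin3 l"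
    by (simp add: fermat_poly_def G_def H_def sum.distrib sum_distrib_right)
  then have eq: "G * lin3 t = fermat_poly d + H * lin3 l" by simp
  have hom_s: "homogeneous 1 (const3 (a $ i) * lin3 s)" for i by (intro homogeneous_cmult homogeneous_lin3)
  have hom_A: "homogeneous 1 (A i)" for i
    unfolding A_def by (intro homogeneous_add homogeneous_cmult homogeneous_lin3)
  have hom_pow: "homogeneous (d - 1) (P ^ (d - Suc j) * Q ^ j)" if "homogeneous 1 P" "homogeneous 1 Q" "j < d" for P Q j
    using homogeneous_mult[OF homogeneous_power[OF that(1), of "d - Suc j"] homogeneous_power[OF that(2), of j]] that(3)
    by simp
  have "homogeneous (d - 1) (g i)" for i
    unfolding g_def by (rule homogeneous_sum) (simp only: lessThan_iff hom_pow[OF hom_s hom_A])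
  then have hom_G: "homogeneous (d - 1) G" unfolding G_def by (intro homogeneous_sum homogeneous_cmult)
  have "eval3 (A i) a = a $ i" for i using lc by (simp add: A_def)
  \<comment> \<open>At \<open>a\<close>, where \<open>s\<close> is 1 and \<open>t\<close> is 0, both
    bases equal \<open>a $ i\<close>, so the \<open>d\<close> terms coincide.\<close>
  then have "eval3 (g i) a = (\<Sum>j<d. a $ i ^ (d - 1))" for i
    unfolding g_def eval3_sum using lc by (intro sum.cong) (simp_all flip: power_add)
  then have "eval3 G a = of_nat d * fermat_grad d a b"
    by (simp add: G_def fermat_grad_def sum_distrib_left mult_ac)
  then have "eval3 G a \<noteq> 0" using grad d by simp
  moreover have "homogeneous d (H * lin3 l)"
  proof -
    have "H * lin3 l = G * lin3 t - fermat_poly d" using eq by simp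
    moreover have "homogeneous d (G * lin3 t)" using homogeneous_mult[OF hom_G homogeneous_lin3, of t] d by simp
    ultimately show ?thesis by (simp add: homogeneous_diff homogeneous_fermat_poly)
  qed
  ultimately show ?thesis using eq hom_G by blast
qed

section \<open>Points and curves through representatives\<close>

lemma proj_plane_cases:
  obtains v where "p = abs_proj_plane v" "v \<noteq> 0"
proof
  show "p = abs_proj_plane (rep_proj_plane p)"
    using Quotient3_abs_rep[OF Quotient3_proj_plane] by metis
  show "rep_proj_plane p \<noteq> 0"
    using Quotient3_rep_reflp[OF Quotient3_proj_plane, of p] unfolding proj_rel_def by blast
qed

lemma abs_proj_plane_eq_iff:
  assumes "v \<noteq> 0" "w \<noteq> 0"
  shows "abs_proj_plane v = abs_proj_plane w \<longleftrightarrow> (\<exists>c. c \<noteq> 0 \<and> v = c *s w)"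
  using Quotient3_rel[OF Quotient3_proj_plane, of v w] assms proj_rel_refl unfolding proj_rel_def by blast

lemma plane_curve_cases:
  obtains f where "C = abs_plane_curve f" "curve_rel f f"
proof
  show "C = abs_plane_curve (rep_plane_curve C)"
    using Quotient3_abs_rep[OF Quotient3_plane_curve] by metis
  show "curve_rel (rep_plane_curve C) (rep_plane_curve C)"
    by (rule Quotient3_rep_reflp[OF Quotient3_plane_curve])
qed

lemma abs_plane_curve_eq_iff:
  "curve_rel f f \<Longrightarrow> curve_rel h h \<Longrightarrow> abs_plane_curve f = abs_plane_curve h \<longleftrightarrow> curve_rel f h"
  using Quotient3_rel[OF Quotient3_plane_curve, of f h] by blast

lemma curve_rel_cmult:
  assumes "curve_rel f f" "c \<noteq> 0"
  shows "curve_rel (const3 c * f) f"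
proof -
  obtain k where k: "f \<noteq> 0" "k \<ge> 1" "homogeneous k f" using assms(1) unfolding curve_rel_def by blast
  have "const3 c * f \<noteq> 0" using k keys_const3_mult[OF assms(2), of f] by (metis keys_eq_empty)
  then show ?thesis
    unfolding curve_rel_def using k assms(2) homogeneous_cmult[OF k(3)] by blast
qed

lemma abs_plane_curve_cmult:
  assumes "curve_rel f f" "c \<noteq> 0"
  shows "abs_plane_curve (const3 c * f) = abs_plane_curve f"
proof -
  have rel: "curve_rel (const3 c * f) f" by (rule curve_rel_cmult[OF assms])
  with assms(1) show ?thesis
    using Quotient3_rel_abs[OF Quotient3_plane_curve] by blast
qed

lemma on_curve_iff:
  "v \<noteq> 0 \<Longrightarrow> curve_rel f f \<Longrightarrow> abs_proj_plane v \<in> curve_points (abs_plane_curve f) \<longleftrightarrow> eval3 f v = 0"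
  by (simp add: curve_points_def on_curve.abs_eq proj_rel_refl)

lemma has_degree_iff: "curve_rel f f \<Longrightarrow> has_degree (abs_plane_curve f) k \<longleftrightarrow> homogeneous k f"
  by (simp add: has_degree.abs_eq)

lemma curve_rel_fermat_poly: "d \<ge> 1 \<Longrightarrow> curve_rel (fermat_poly d) (fermat_poly d)"
  using curve_rel_refl fermat_poly_nonzero homogeneous_fermat_poly by blast

lemma invertible_mult_nonzero: "invertible A \<Longrightarrow> v \<noteq> 0 \<Longrightarrow> A *v v \<noteq> (0 :: complex ^ 3)"
  by (metis invertible_def matrix_vector_mul_assoc matrix_vector_mul_lid matrix_vector_mult_0_right)

section \<open>Intersection with a line\<close>

text \<open>The point \<open>a\<close> of the line, which is off the curve, is used as point at
  infinity: all intersections lie in the chart \<open>b + x *s a\<close>, where they are the roots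
  of a polynomial of degree at most \<open>n\<close>.\<close>

lemma card_line_intersection:
  assumes h: "homogeneous n h" "n \<ge> 1" and a: "bil3 l a = 0" "eval3 h a \<noteq> 0" and "l \<noteq> 0"
  shows "finite {abs_proj_plane v | v. v \<noteq> 0 \<and> bil3 l v = 0 \<and> eval3 h v = 0} \<and>
    card {abs_proj_plane v | v. v \<noteq> 0 \<and> bil3 l v = 0 \<and> eval3 h v = 0} \<le> n"
proof -
  have "eval3 h 0 = 0" using eval3_scale[OF h(1), of 0 0] h(2) by (simp add: power_0_left)
  then have "a \<noteq> 0" using a by auto
  then obtain b e s t where lc: "line_coords l a b e s t"
    using line_coords_exist[OF _ \<open>l \<noteq> 0\<close> a(1)] by blast
  then have tb: "bil3 t b = 1" "bil3 t a = 0" unfolding line_coords_def by blast+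
  have v: "v = bil3 s v *s a + bil3 t v *s b" if "bil3 l v = 0" for v
  proof -
    have "v = bil3 s v *s a + bil3 t v *s b + bil3 l v *s e" using lc unfolding line_coords_def by blast
    with that show ?thesis by simp
  qed
  define p where "p = line_poly h b a"
  have swap: "eval3 h (x *s a + y *s b) = y ^ n * poly p (x / y)" if "y \<noteq> 0" for x y
  proof -
    have "x *s a + y *s b = y *s (b + (x / y) *s a)" using that by (simp add: vec_eq_iff field_simps)
    then show ?thesis by (simp only: p_def poly_line_poly eval3_scale[OF h(1)])
  qed
  \<comment> \<open>If \<open>p\<close> were 0, then \<open>h\<close> would vanish at
    \<open>a + y *s b\<close> for every nonzero \<open>y\<close>, hence also for
    \<open>y = 0\<close>.\<close>
  have "p \<noteq> 0"
  proof
    assume "p = 0"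
    have "poly (line_poly h a b) y = 0" if "y \<noteq> 0" for y
      using swap[OF that, of 1] \<open>p = 0\<close> by (simp add: poly_line_poly)
    then have "- {0} \<subseteq> {y. poly (line_poly h a b) y = 0}" by blast
    moreover have "infinite (- {0 :: complex})"
      using infinite_UNIV_char_0 by (simp add: Compl_eq_Diff_UNIV)
    ultimately have "infinite {y. poly (line_poly h a b) y = 0}" using finite_subset by blast
    then have "line_poly h a b = 0" using poly_roots_finite by blast
    then have "poly (line_poly h a b) 0 = 0" by simp
    with a(2) show False by (simp add: poly_line_poly)
  qed
  define R where "R = {x. poly p x = 0}"
  have "finite R" unfolding R_def using \<open>p \<noteq> 0\<close> by (rule poly_roots_finite)
  have "card R \<le> degree p" unfolding R_def using \<open>p \<noteq> 0\<close> by (rule card_poly_roots_bound)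
  also have "\<dots> \<le> n" unfolding p_def by (rule degree_line_poly_homogeneous[OF h(1)])
  finally have "card R \<le> n" .
  have "{abs_proj_plane v | v. v \<noteq> 0 \<and> bil3 l v = 0 \<and> eval3 h v = 0} \<subseteq> (\<lambda>x. abs_proj_plane (b + x *s a)) ` R"
  proof clarify
    fix w
    assume w: "w \<noteq> 0" "bil3 l w = 0" "eval3 h w = 0"
    define x y where "x = bil3 s w" and "y = bil3 t w"
    have wxy: "w = x *s a + y *s b" using v[OF w(2)] by (simp add: x_def y_def)
    have "y \<noteq> 0"
    proof
      assume "y = 0"
      then have "w = x *s a" using wxy by simp
      with w a have "x = 0" by (simp add: eval3_scale[OF h(1)])
      with \<open>w = x *s a\<close> w(1) show False by simp
    qed
    have "x / y \<in> R" using w(3) swap[OF \<open>y \<noteq> 0\<close>, of x] \<open>y \<noteq> 0\<close> by (simp add: wxy R_def)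
    moreover have wy: "w = y *s (b + (x / y) *s a)" using \<open>y \<noteq> 0\<close> by (simp add: wxy vec_eq_iff field_simps)
    moreover have "b + (x / y) *s a \<noteq> 0"
    proof
      assume "b + (x / y) *s a = 0"
      then show False using wy w(1) by (simp only: vector_smult_rzero)
    qed
    ultimately have "x / y \<in> R" "abs_proj_plane w = abs_proj_plane (b + (x / y) *s a)"
      using w(1) \<open>y \<noteq> 0\<close> abs_proj_plane_eq_iff[of w "b + (x / y) *s a"] by blast+
    then show "abs_proj_plane w \<in> (\<lambda>x. abs_proj_plane (b + x *s a)) ` R" by blast
  qed
  then show ?thesis
    using \<open>finite R\<close> \<open>card R \<le> n\<close>
    by (meson card_image_le card_mono finite_imageI finite_subset order_trans)
qed

lemma curve_points_line:
  assumes "curve_rel h h" "curve_rel (lin3 l) (lin3 l)"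
  shows "curve_points (abs_plane_curve h) \<inter> curve_points (abs_plane_curve (lin3 l)) =
    {abs_proj_plane v | v. v \<noteq> 0 \<and> bil3 l v = 0 \<and> eval3 h v = 0}"
proof (intro equalityI subsetI)
  fix x
  assume x: "x \<in> curve_points (abs_plane_curve h) \<inter> curve_points (abs_plane_curve (lin3 l))"
  obtain v where v: "x = abs_proj_plane v" "v \<noteq> 0" by (rule proj_plane_cases)
  with x show "x \<in> {abs_proj_plane v | v. v \<noteq> 0 \<and> bil3 l v = 0 \<and> eval3 h v = 0}"
    using on_curve_iff[OF v(2)] assms by auto
next
  fix x
  assume "x \<in> {abs_proj_plane v | v. v \<noteq> 0 \<and> bil3 l v = 0 \<and> eval3 h v = 0}"
  then obtain v where "x = abs_proj_plane v" "v \<noteq> 0" "bil3 l v = 0" "eval3 h v = 0" by blast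
  then show "x \<in> curve_points (abs_plane_curve h) \<inter> curve_points (abs_plane_curve (lin3 l))"
    using assms by (simp add: on_curve_iff)
qed

text \<open>The ideal for \<open>m * h\<close> is contained in that for \<open>l * h\<close>, so its
  quotient has at least the same dimension.\<close>

lemma intersection_mult_exchange:
  assumes "homogeneous r G" "eval3 G v \<noteq> 0" "homogeneous s m" "m \<noteq> 0"
    and "homogeneous (r + s) (K * f)" "homogeneous (r + s) (H * l)" "G * m = K * f + H * l"
    and f: "curve_rel f f" and lh: "curve_rel (l * h) (l * h)" and mh: "curve_rel (m * h) (m * h)" and v: "v \<noteq> 0"
  shows "intersection_mult (abs_plane_curve f) (abs_plane_curve (l * h)) (abs_proj_plane v) \<le>
    intersection_mult (abs_plane_curve f) (abs_plane_curve (m * h)) (abs_proj_plane v)"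
  unfolding intersection_mult.abs_eq[OF f lh proj_rel_refl[OF v]] intersection_mult.abs_eq[OF f mh proj_rel_refl[OF v]]
  by (intro quotient_dim_antimono local_ideal_exchange[OF assms(1-7)])

section \<open>Automorphisms with a pointwise fixed line\<close>

text \<open>All nonzero vectors over the line are eigenvectors, and comparing \<open>a\<close>,
  \<open>b\<close> and \<open>a + b\<close> shows that they share one eigenvalue
  \<open>\<alpha>\<close>. The vector \<open>u\<close> is the deviation of \<open>A\<close> from
  this scalar at \<open>e\<close>.\<close>

lemma line_fixed_pointwise:
  assumes A: "invertible A" and lc: "line_coords l a b e s t"
    and fixed: "\<And>v. v \<noteq> 0 \<Longrightarrow> bil3 l v = 0 \<Longrightarrow> abs_proj_plane (A *v v) = abs_proj_plane v"
  shows "\<exists>\<alpha> u. \<alpha> \<noteq> 0 \<and> (\<forall>v. A *v v = \<alpha> *s v + bil3 l v *s u)"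
proof -
  have c: "bil3 s a = 1" "bil3 s b = 0" "bil3 t a = 0" "bil3 t b = 1" "bil3 l a = 0" "bil3 l b = 0"
    "v = bil3 s v *s a + bil3 t v *s b + bil3 l v *s e" for v
    using lc unfolding line_coords_def by blast+
  have bil0: "bil3 x 0 = 0" for x by (simp add: bil3_def)
  have nz: "a \<noteq> 0" "b \<noteq> 0" "a + b \<noteq> 0"
    using c bil0 bil3_add[of s a b] by auto
  have eigen: "\<exists>\<gamma>. \<gamma> \<noteq> 0 \<and> A *v v = \<gamma> *s v" if "v \<noteq> 0" "bil3 l v = 0" for v
    using fixed[OF that] abs_proj_plane_eq_iff[OF invertible_mult_nonzero[OF A that(1)] that(1)] by blast
  obtain \<alpha> where \<alpha>: "\<alpha> \<noteq> 0" "A *v a = \<alpha> *s a" using eigen nz c by blast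
  obtain \<beta> where \<beta>: "A *v b = \<beta> *s b" using eigen nz c by blast
  have "bil3 l (a + b) = 0" by (simp add: bil3_add c)
  then obtain \<gamma> where \<gamma>: "A *v (a + b) = \<gamma> *s (a + b)" using eigen nz by blast
  have eq: "\<alpha> *s a + \<beta> *s b = \<gamma> *s (a + b)"
    using \<gamma> \<alpha> \<beta> by (simp add: matrix_vector_right_distrib)
  have "\<alpha> = \<gamma>" using arg_cong[OF eq, of "bil3 s"] by (simp add: bil3_add bil3_scale c)
  moreover have "\<beta> = \<gamma>" using arg_cong[OF eq, of "bil3 t"] by (simp add: bil3_add bil3_scale c)
  ultimately have \<beta>: "A *v b = \<alpha> *s b" using \<beta> by simp
  define u where "u = A *v e - \<alpha> *s e"
  have "A *v v = \<alpha> *s v + bil3 l v *s u" for v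
  proof -
    define x y z where "x = bil3 s v" and "y = bil3 t v" and "z = bil3 l v"
    have v: "v = x *s a + y *s b + z *s e" unfolding x_def y_def z_def by (rule c(7))
    have "A *v v = x *s (A *v a) + y *s (A *v b) + z *s (A *v e)"
      unfolding v by (simp add: matrix_vector_right_distrib vector_scalar_commute)
    also have "\<dots> = \<alpha> *s (x *s a + y *s b + z *s e) + z *s u"
      by (simp add: \<alpha> \<beta> u_def vec_eq_iff algebra_simps)
    also have "\<dots> = \<alpha> *s v + bil3 l v *s u" by (simp only: v[symmetric] z_def[symmetric])
    finally show ?thesis .
  qed
  with \<alpha>(1) show ?thesis by blast
qed

text \<open>The pullback of \<open>F\<close> vanishes on the curve and has the same degree, so
  \<open>fermat_nullstellensatz\<close> applies.\<close>

lemma fermat_poly_automorphism: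
  assumes d: "d \<ge> 1" and A: "invertible A"
    and g: "\<And>v. v \<noteq> 0 \<Longrightarrow> g (abs_proj_plane v) = abs_proj_plane (A *v v)"
    and im: "g ` curve_points (fermat_curve d) \<subseteq> curve_points (fermat_curve d)"
  shows "\<exists>c. c \<noteq> 0 \<and> subst3 A (fermat_poly d) = const3 c * fermat_poly d"
proof -
  note rel = curve_rel_fermat_poly[OF d]
  have "eval3 (subst3 A (fermat_poly d)) v = 0" if zero: "eval3 (fermat_poly d) v = 0" for v
  proof (cases "v = 0")
    case True
    then show ?thesis using zero by simp
  next
    case False
    then have "abs_proj_plane v \<in> curve_points (fermat_curve d)"
      using zero by (simp add: fermat_curve_fermat_poly on_curve_iff rel)
    then have "abs_proj_plane (A *v v) \<in> curve_points (fermat_curve d)"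
      using im g[OF False] by (metis image_subset_iff)
    then show ?thesis
      by (simp add: fermat_curve_fermat_poly on_curve_iff rel invertible_mult_nonzero[OF A False])
  qed
  then obtain c where c: "subst3 A (fermat_poly d) = const3 c * fermat_poly d"
    using fermat_nullstellensatz[OF d homogeneous_subst3[OF homogeneous_fermat_poly]] by blast
  moreover have "c \<noteq> 0"
  proof
    assume "c = 0"
    then have "subst3 A (fermat_poly d) = 0" by (simp add: c const3_def)
    then show False using subst3_eq_0_iff[OF A] fermat_poly_nonzero[OF d] by blast
  qed
  ultimately show ?thesis by blast
qed

section \<open>Osculating curves\<close>

lemma osculating_curveI:
  "\<exists>!D. is_osculating_curve n C p D \<Longrightarrow> is_osculating_curve n C p (osculating_curve n C p)"
  unfolding osculating_curve_def by (rule theI')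

lemma osculating_curve_unique:
  "\<exists>!D. is_osculating_curve n C p D \<Longrightarrow> is_osculating_curve n C p D \<Longrightarrow> osculating_curve n C p = D"
  unfolding osculating_curve_def by (rule the1_equality)

lemma curve_rel_lin3: "l \<noteq> 0 \<Longrightarrow> curve_rel (lin3 l) (lin3 l)"
proof -
  assume "l \<noteq> 0"
  then obtain i where "l $ i \<noteq> 0" by (auto simp: vec_eq_iff)
  then have "eval3 (lin3 l) (axis i 1) \<noteq> 0" by (simp add: bil3_axis)
  then have "lin3 l \<noteq> 0" by (metis eval3_0)
  then show ?thesis by (rule curve_rel_refl[OF _ order_refl homogeneous_lin3])
qed

text \<open>If the osculating curve contained the axis \<open>l = 0\<close>, then this component could be exchanged for
  another line with the same or a larger local contribution: an arbitrary line if the point is not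
  on the axis, and any line through the point otherwise, as the axis is not tangent there.\<close>

lemma osculating_curve_not_contains_axis:
  assumes d: "d \<ge> 2" and "l \<noteq> 0" and "u \<noteq> 0"
    and inv: "\<And>v. eval3 (fermat_poly d) (v + bil3 l v *s u) = c * eval3 (fermat_poly d) v"
    and v0: "v0 \<noteq> 0" "eval3 (fermat_poly d) v0 = 0"
    and unique: "\<exists>!D. is_osculating_curve n (fermat_curve d) (abs_proj_plane v0) D"
    and h: "curve_rel h h" "is_osculating_curve n (fermat_curve d) (abs_proj_plane v0) (abs_plane_curve h)"
  shows "\<exists>v. bil3 l v = 0 \<and> eval3 h v \<noteq> 0"
proof (rule ccontr)
  assume "\<not> ?thesis"
  then have h_zero: "\<And>v. bil3 l v = 0 \<Longrightarrow> eval3 h v = 0" by blast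
  have "d \<ge> 1" using d by simp
  \<comment> \<open>If \<open>v0\<close> lies on the axis, then \<open>a\<close> is
    \<open>v0\<close>, so that the replacing line \<open>t = 0\<close> passes through it.\<close>
  have "\<exists>a. a \<noteq> 0 \<and> bil3 l a = 0 \<and> (bil3 l v0 = 0 \<longrightarrow> a = v0)"
    using exists_bil3_eq_0[of l] v0(1) by (cases "bil3 l v0 = 0") auto
  then obtain a where a: "a \<noteq> 0" "bil3 l a = 0" "bil3 l v0 = 0 \<Longrightarrow> a = v0" by blast
  obtain b e s t where lc: "line_coords l a b e s t"
    using line_coords_exist[OF a(1) \<open>l \<noteq> 0\<close> a(2)] by blast
  then have c: "bil3 s a = 1" "bil3 t a = 0" "bil3 t b = 1" "bil3 l a = 0" "bil3 l b = 0" "bil3 l e = 1"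
    "v = bil3 s v *s a + bil3 t v *s b + bil3 l v *s e" for v
    unfolding line_coords_def by blast+
  obtain h' where h': "h = lin3 l * h'" using lin3_dvd[OF c(6) h_zero] by (auto elim: dvdE)
  have hn: "homogeneous n h" using h by (simp add: is_osculating_curve_def has_degree_iff)
  have "t \<noteq> 0" using c(3) by (auto simp: bil3_def)
  have lin_nz: "lin3 l \<noteq> 0" "lin3 t \<noteq> 0"
    using curve_rel_lin3[OF \<open>l \<noteq> 0\<close>] curve_rel_lin3[OF \<open>t \<noteq> 0\<close>] unfolding curve_rel_def by blast+
  have "h' \<noteq> 0" using h(1) h' by (auto simp: curve_rel_def)
  then obtain k where k: "n = 1 + k" "homogeneous k h'"
    using homogeneous_factor[OF homogeneous_lin3 lin_nz(1), of n h'] hn h' by blast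
  have rel: "curve_rel (lin3 t * h') (lin3 t * h')"
    using lin_nz \<open>h' \<noteq> 0\<close> homogeneous_mult[OF homogeneous_lin3 k(2), of t] by (intro curve_rel_refl[of _ "1 + k"]) simp_all
  have "\<exists>r G K H. homogeneous r G \<and> eval3 G v0 \<noteq> 0 \<and> homogeneous (r + 1) (K * fermat_poly d) \<and>
      homogeneous (r + 1) (H * lin3 l) \<and> G * lin3 t = K * fermat_poly d + H * lin3 l"
  proof (cases "bil3 l v0 = 0")
    case True
    with a have av0: "a = v0" by blast
    obtain w where w: "bil3 l w = 0" "fermat_grad d v0 w \<noteq> 0"
      using fermat_axis_transversal[OF d lc \<open>u \<noteq> 0\<close> v0(1) True inv] by blast
    \<comment> \<open>Euler's relation: the derivative in direction \<open>v0\<close> is 0, so a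
      nonzero derivative along the axis must come from \<open>b\<close>.\<close>
    have "fermat_grad d v0 v0 = eval3 (fermat_poly d) v0"
      using \<open>d \<ge> 1\<close> by (simp add: fermat_grad_def eval3_fermat_poly flip: power_Suc)
    then have "fermat_grad d v0 v0 = 0" using v0(2) by simp
    moreover have "w = bil3 s w *s v0 + bil3 t w *s b" using c(7)[of w] w(1) av0 by simp
    ultimately have "fermat_grad d v0 w = bil3 t w * fermat_grad d v0 b"
      by (metis fermat_grad_add fermat_grad_scale mult_zero_right add_0)
    with w(2) have "fermat_grad d v0 b \<noteq> 0" by auto
    then obtain G H where "G * lin3 t = fermat_poly d + H * lin3 l" "homogeneous (d - 1) G" "eval3 G v0 \<noteq> 0"
      "homogeneous d (H * lin3 l)"
      using fermat_line_exchange[OF \<open>d \<ge> 1\<close> lc[unfolded av0] v0(2)] by blast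
    then show ?thesis
      using \<open>d \<ge> 1\<close> homogeneous_fermat_poly[of d]
      by (intro exI[of _ "d - 1"] exI[of _ G] exI[of _ 1] exI[of _ H]) simp
  next
    case False
    \<comment> \<open>Here \<open>l\<close> is a unit at \<open>v0\<close>, and the relation is just
      \<open>l * t = t * l\<close> with \<open>K = 0\<close>.\<close>
    then show ?thesis
      using homogeneous_mult[OF homogeneous_lin3 homogeneous_lin3, of t l]
      by (intro exI[of _ "1::nat"] exI[of _ "lin3 l"] exI[of _ "0::poly3"] exI[of _ "lin3 t"])
        (simp add: mult.commute homogeneous_lin3[unfolded One_nat_def] del: One_nat_def)
  qed
  then obtain r G K H where G: "homogeneous r G" "eval3 G v0 \<noteq> 0" "homogeneous (r + 1) (K * fermat_poly d)"
    "homogeneous (r + 1) (H * lin3 l)" "G * lin3 t = K * fermat_poly d + H * lin3 l" by blast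
  have "intersection_mult (fermat_curve d) (abs_plane_curve h) (abs_proj_plane v0) \<le>
      intersection_mult (fermat_curve d) (abs_plane_curve (lin3 t * h')) (abs_proj_plane v0)"
    unfolding fermat_curve_fermat_poly h'
    by (rule intersection_mult_exchange[OF G(1,2) homogeneous_lin3 lin_nz(2) G(3,4,5)
        curve_rel_fermat_poly[OF \<open>d \<ge> 1\<close>] h(1)[unfolded h'] rel v0(1)])
  moreover have "homogeneous n (lin3 t * h')"
    unfolding k(1) by (intro homogeneous_mult homogeneous_lin3 k(2))
  ultimately have "is_osculating_curve n (fermat_curve d) (abs_proj_plane v0) (abs_plane_curve (lin3 t * h'))"
    using h(2) unfolding is_osculating_curve_def has_degree_iff[OF rel] by (blast intro: order_trans)
  then have "abs_plane_curve (lin3 t * h') = abs_plane_curve (lin3 l * h')"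
    using unique h(2) unfolding h' by blast
  then have "curve_rel (lin3 t * h') (lin3 l * h')"
    using abs_plane_curve_eq_iff[OF rel h(1)[unfolded h']] by blast
  then obtain \<kappa> where "lin3 t * h' = const3 \<kappa> * (lin3 l * h')" unfolding curve_rel_def by blast
  then have "lin3 t * h' = (const3 \<kappa> * lin3 l) * h'" by (simp only: mult.assoc)
  then have "lin3 t = const3 \<kappa> * lin3 l" using \<open>h' \<noteq> 0\<close> by simp
  \<comment> \<open>At \<open>b\<close> the form \<open>t\<close> is 1 and \<open>l\<close> is
    0.\<close>
  then have "eval3 (lin3 t) b = eval3 (const3 \<kappa> * lin3 l) b" by (rule arg_cong)
  then show False by (simp add: c)
qed

text \<open>Pulling back along \<open>A\<close> maps the Fermat curve to itself and preserves
  degrees and intersection multiplicities.\<close>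

lemma osculating_curve_subst3:
  assumes A: "invertible A" and g: "\<And>v. v \<noteq> 0 \<Longrightarrow> g (abs_proj_plane v) = abs_proj_plane (A *v v)"
    and d: "d \<ge> 1" and F: "c \<noteq> 0" "subst3 A (fermat_poly d) = const3 c * fermat_poly d"
    and h: "curve_rel h h" and osc: "is_osculating_curve n (fermat_curve d) (g q) (abs_plane_curve h)"
  shows "is_osculating_curve n (fermat_curve d) q (abs_plane_curve (subst3 A h))"
proof -
  note rel = curve_rel_fermat_poly[OF d]
  obtain v where v: "q = abs_proj_plane v" "v \<noteq> 0" by (rule proj_plane_cases)
  have "intersection_mult (fermat_curve d) (abs_plane_curve (subst3 A h)) q =
      intersection_mult (fermat_curve d) (abs_plane_curve h) (g q)"
    using intersection_mult_subst3[OF A rel h v(2)]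
    unfolding F(2) abs_plane_curve_cmult[OF rel F(1)] fermat_curve_fermat_poly v(1) g[OF v(2)] .
  with osc h show ?thesis
    by (simp add: is_osculating_curve_def has_degree_iff curve_rel_subst3[OF A] homogeneous_subst3)
qed

section \<open>Invariants along an orbit\<close>

lemma cyclic_orbit_closed: "q \<in> cyclic_orbit g p \<Longrightarrow> g q \<in> cyclic_orbit g p"
proof -
  assume "q \<in> cyclic_orbit g p"
  then obtain k where "(g ^^ k) p = q \<or> (g ^^ k) q = p" unfolding cyclic_orbit_def by blast
  \<comment> \<open>A backward step count of 0 means \<open>q = p\<close>, which the first
    alternative covers.\<close>
  then consider "(g ^^ k) p = q" | j where "(g ^^ Suc j) q = p"
    by (cases k) auto
  then show ?thesis
  proof cases
    case 1
    then have "(g ^^ Suc k) p = g q" by simp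
    then show ?thesis unfolding cyclic_orbit_def by blast
  next
    case 2
    then have "(g ^^ j) (g q) = p" by (simp add: funpow_swap1)
    then show ?thesis unfolding cyclic_orbit_def by blast
  qed
qed

text \<open>Each point of the orbit is reached from \<open>p\<close> or reaches \<open>p\<close> by
  forward steps, and these stay inside the orbit.\<close>

lemma cyclic_orbit_invariant:
  assumes step: "\<And>q. q \<in> cyclic_orbit g p \<Longrightarrow> T (g q) = T q" and q: "q \<in> cyclic_orbit g p"
  shows "T q = T p"
proof -
  have p: "p \<in> cyclic_orbit g p" unfolding cyclic_orbit_def by (auto intro: exI[of _ 0])
  have iter: "(g ^^ k) x \<in> cyclic_orbit g p \<and> T ((g ^^ k) x) = T x" if "x \<in> cyclic_orbit g p" for x k
    by (induction k) (use that in \<open>simp_all add: cyclic_orbit_closed step\<close>)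
  from q obtain k where "(g ^^ k) p = q \<or> (g ^^ k) q = p" unfolding cyclic_orbit_def by blast
  then show ?thesis using iter[OF p, of k] iter[OF q, of k] by auto
qed

theorem corollary4p15:
  fixes d n :: nat
    and g :: "proj_plane \<Rightarrow> proj_plane"
    and L :: plane_curve
    and p :: proj_plane
    and P :: "proj_plane set"
  assumes "d \<ge> 3"
    and "n \<ge> 1"
    and "proj_automorphism g"
    and "g ` curve_points (fermat_curve d) = curve_points (fermat_curve d)"
    and "g \<noteq> id"
    and "has_degree L 1"
    and "\<forall>q\<in>curve_points L. g q = q"
    and "p \<in> curve_points (fermat_curve d)"
    and "P = cyclic_orbit g p"
    and "\<forall>q\<in>P. \<exists>!D. is_osculating_curve n (fermat_curve d) q D"
  shows "\<exists>S. finite S \<and> card S \<le> n \<and>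
    (\<forall>q\<in>P. curve_points (osculating_curve n (fermat_curve d) q) \<inter> curve_points L = S) \<and>
    (\<forall>x\<in>S. \<exists>m. \<forall>q\<in>P. intersection_mult (osculating_curve n (fermat_curve d) q) L x = m)"
proof -
  have d: "d \<ge> 1" "d \<ge> 2" using assms(1) by simp_all
  obtain A :: "complex ^ 3 ^ 3" where A: "invertible A"
    and g: "\<And>v. v \<noteq> 0 \<Longrightarrow> g (abs_proj_plane v) = abs_proj_plane (A *v v)"
    using assms(3) unfolding proj_automorphism_def by blast
  obtain c where c: "c \<noteq> 0" "subst3 A (fermat_poly d) = const3 c * fermat_poly d"
    using fermat_poly_automorphism[OF d(1) A g] assms(4) by blast
  obtain f where f: "L = abs_plane_curve f" "curve_rel f f" by (rule plane_curve_cases)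
  with assms(6) have "homogeneous 1 f" using has_degree_iff by blast
  then obtain l where fl: "f = lin3 l" by (rule homogeneous_1_lin3)
  have "l \<noteq> 0"
  proof
    assume "l = 0"
    then have "f = 0" unfolding fl by (intro eval3_eqI) (simp add: bil3_def)
    with f(2) show False by (simp add: curve_rel_def)
  qed
  note L = f(1)[unfolded fl] and rel_l = f(2)[unfolded fl]
  have fixed: "abs_proj_plane (A *v v) = abs_proj_plane v" if "v \<noteq> 0" "bil3 l v = 0" for v
  proof -
    have "abs_proj_plane v \<in> curve_points L" using that by (simp add: L on_curve_iff rel_l)
    then show ?thesis using assms(7) g[OF that(1)] by simp
  qed
  obtain a b e s t where lc: "line_coords l a b e s t"
    using exists_bil3_eq_0 line_coords_exist[OF _ \<open>l \<noteq> 0\<close>] by blast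
  obtain \<alpha> u where "\<alpha> \<noteq> 0" and Av: "\<And>v. A *v v = \<alpha> *s v + bil3 l v *s u"
    using line_fixed_pointwise[OF A lc fixed] by blast
  define u' where "u' = inverse \<alpha> *s u"
  have Av': "A *v v = \<alpha> *s (v + bil3 l v *s u')" for v
    using \<open>\<alpha> \<noteq> 0\<close> by (simp add: Av u'_def vec_eq_iff field_simps)
  \<comment> \<open>Otherwise \<open>A\<close> is scalar and \<open>g\<close> is the
    identity.\<close>
  have "u' \<noteq> 0"
  proof
    assume "u' = 0"
    have "g x = x" for x
    proof -
      obtain v where v: "x = abs_proj_plane v" "v \<noteq> 0" by (rule proj_plane_cases)
      have "A *v v = \<alpha> *s v" using Av'[of v] \<open>u' = 0\<close> by simp
      then show ?thesis
        using v g[OF v(2)] \<open>\<alpha> \<noteq> 0\<close> abs_proj_plane_eq_iff[OF invertible_mult_nonzero[OF A v(2)] v(2)] by auto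
    qed
    with assms(5) show False by (auto simp: fun_eq_iff)
  qed
  have inv: "eval3 (fermat_poly d) (v + bil3 l v *s u') = c / \<alpha> ^ d * eval3 (fermat_poly d) v" for v
  proof -
    have "\<alpha> ^ d * eval3 (fermat_poly d) (v + bil3 l v *s u') = eval3 (subst3 A (fermat_poly d)) v"
      unfolding eval3_subst3 Av' by (rule eval3_scale[OF homogeneous_fermat_poly, symmetric])
    also have "\<dots> = c * eval3 (fermat_poly d) v" by (simp add: c(2))
    finally show ?thesis using \<open>\<alpha> \<noteq> 0\<close> by (simp add: field_simps)
  qed
  \<comment> \<open>Comparing multiplicities with \<open>L\<close> requires that the pullback of
    \<open>l\<close> is again an equation of \<open>L\<close>; the factor is nonzero as
    \<open>A\<close> is invertible.\<close>
  have "subst3 A (lin3 l) = const3 (\<alpha> + bil3 l u) * lin3 l"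
    by (rule eval3_eqI) (simp add: Av bil3_add bil3_scale algebra_simps)
  moreover have "subst3 A (lin3 l) \<noteq> 0"
    using rel_l subst3_eq_0_iff[OF A] by (auto simp: curve_rel_def)
  then have "\<alpha> + bil3 l u \<noteq> 0" using calculation by (auto simp: const3_def)
  ultimately have L_inv: "abs_plane_curve (subst3 A (lin3 l)) = L"
    unfolding L using abs_plane_curve_cmult[OF rel_l] by simp

  define osc where "osc q = osculating_curve n (fermat_curve d) q" for q
  \<comment> \<open>The default 0 off \<open>L\<close> makes the second component total, so that
    agreement along \<open>L\<close> becomes an equality of values of \<open>T\<close>.\<close>
  define T where "T q = (curve_points (osc q) \<inter> curve_points L,
    \<lambda>x. if x \<in> curve_points L then intersection_mult (osc q) L x else 0)" for q
  have osc: "is_osculating_curve n (fermat_curve d) q (osc q)" if "q \<in> P" for q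
    unfolding osc_def using bspec[OF assms(10) that] by (rule osculating_curveI)
  have step: "T (g q) = T q" if q: "q \<in> P" for q
  proof -
    have gq: "g q \<in> P" using q unfolding assms(9) by (rule cyclic_orbit_closed)
    obtain h where h: "osc (g q) = abs_plane_curve h" "curve_rel h h" by (rule plane_curve_cases)
    \<comment> \<open>The pullback of the osculating curve at \<open>g q\<close> osculates at
      \<open>q\<close>, and uniqueness identifies it.\<close>
    have "osc q = abs_plane_curve (subst3 A h)"
      unfolding osc_def
      by (rule osculating_curve_unique[OF bspec[OF assms(10) q]
          osculating_curve_subst3[OF A g d(1) c h(2) osc[OF gq, unfolded h(1)]]])
    note osc_q = this and rel_h = curve_rel_subst3[OF A h(2)]
    have pts: "x \<in> curve_points (osc q) \<longleftrightarrow> x \<in> curve_points (osc (g q))"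
      and mult: "intersection_mult (osc q) L x = intersection_mult (osc (g q)) L x" if x: "x \<in> curve_points L" for x
    proof -
      obtain v where v: "x = abs_proj_plane v" "v \<noteq> 0" by (rule proj_plane_cases)
      have gx: "abs_proj_plane (A *v v) = x" using bspec[OF assms(7) x] unfolding v(1) g[OF v(2)] .
      have "x \<in> curve_points (osc q) \<longleftrightarrow> eval3 h (A *v v) = 0"
        unfolding osc_q v(1) using on_curve_iff[OF v(2) rel_h] by simp
      also have "\<dots> \<longleftrightarrow> abs_proj_plane (A *v v) \<in> curve_points (osc (g q))"
        unfolding h(1) using on_curve_iff[OF invertible_mult_nonzero[OF A v(2)] h(2)] by simp
      finally show "x \<in> curve_points (osc q) \<longleftrightarrow> x \<in> curve_points (osc (g q))" unfolding gx .
      show "intersection_mult (osc q) L x = intersection_mult (osc (g q)) L x"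
        using intersection_mult_subst3[OF A h(2) rel_l v(2)]
        unfolding L_inv gx L[symmetric] h(1)[symmetric] osc_q[symmetric] v(1)[symmetric] .
    qed
    show ?thesis unfolding T_def using pts mult by auto
  qed
  have T: "T q = T p" if "q \<in> P" for q
    by (rule cyclic_orbit_invariant[of g p T, folded assms(9), OF step that])

  \<comment> \<open>The points on \<open>L\<close> are the same for the whole orbit, so bounding
    their number at \<open>p\<close> suffices.\<close>
  obtain v0 where v0: "p = abs_proj_plane v0" "v0 \<noteq> 0" by (rule proj_plane_cases)
  have "p \<in> P" unfolding assms(9) cyclic_orbit_def by (auto intro: exI[of _ 0])
  obtain h where h: "osc p = abs_plane_curve h" "curve_rel h h" by (rule plane_curve_cases)
  have F0: "eval3 (fermat_poly d) v0 = 0"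
    using assms(8) unfolding v0(1) fermat_curve_fermat_poly
    using on_curve_iff[OF v0(2) curve_rel_fermat_poly[OF d(1)]] by simp
  have "\<exists>v. bil3 l v = 0 \<and> eval3 h v \<noteq> 0"
    by (rule osculating_curve_not_contains_axis[OF d(2) \<open>l \<noteq> 0\<close> \<open>u' \<noteq> 0\<close> inv v0(2) F0
        bspec[OF assms(10) \<open>p \<in> P\<close>, unfolded v0(1)] h(2) osc[OF \<open>p \<in> P\<close>, unfolded h(1), unfolded v0(1)]])
  then obtain v where v: "bil3 l v = 0" "eval3 h v \<noteq> 0" by blast
  have "homogeneous n h"
    using osc[OF \<open>p \<in> P\<close>] by (simp add: h(1) is_osculating_curve_def has_degree_iff[OF h(2)])
  note fin = card_line_intersection[OF this assms(2) v \<open>l \<noteq> 0\<close>]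
  define S where "S = curve_points (osc p) \<inter> curve_points L"
  have "finite S \<and> card S \<le> n"
    using fin unfolding S_def h(1) L curve_points_line[OF h(2) rel_l] .
  moreover have "curve_points (osc q) \<inter> curve_points L = S" if "q \<in> P" for q
    using T[OF that] by (simp add: T_def S_def)
  moreover have "intersection_mult (osc q) L x = intersection_mult (osc p) L x" if "x \<in> S" "q \<in> P" for x q
    using fun_cong[OF arg_cong[OF T[OF that(2)], of snd], of x] that(1) by (simp add: T_def S_def)
  ultimately show ?thesis unfolding osc_def by blast
qed

end
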